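(* Let $m = e^{-V}\mathcal{L}^1$ be a probability measure on $\mathbb{R}$ such that $V \in C^{\infty}(\mathbb{R})$ is $\kappa$-convex for some $\kappa>0$. Assume that $0$ is a minimizer of $V$ on $\mathbb{R}$. Let $F,G$ be measurable functions on $\mathbb{R}$ satisfying $0<\int_{\mathbb{R}}e^{\kappa F} \,dm<\infty$, $\int_{\mathbb{R}}x^2e^{\kappa F} \,dm<\infty$, $0<\int_{\mathbb{R}}e^{\kappa G} \,dm<\infty$ and $\int_{\mathbb{R}}x^2e^{\kappa G} \,dm<\infty$. Set $\mu_F:=e^{\kappa F} m/\int_{\mathbb{R}} e^{\kappa F} \,dm$, $\mu_G:=e^{\kappa G} m/\int_{\mathbb{R}} e^{\kappa G} \,dm$, $\alpha_{m,F}:=\alpha_{m,\mu_F}$, $\alpha_{m,G}:=\alpha_{m,\mu_G}$ and \[ \Phi(m,F,G):=-\alpha_{m,G}\mathrm{bar}(\mu_F) - \alpha_{m,F}\mathrm{bar}(\mu_G) + \alpha_{m,F}\alpha_{m,G}+(\alpha_{m,F}+\alpha_{m,G})\mathrm{bar}(m). \] If $F(x) + G(y) \leq (x-y)^2/2$ holds for any $(x,y)\in \mathbb{R}\times\mathbb{R}$, then \[ \int_{\mathbb{R}}e^{\kappa F} \,dm\int_{\mathbb{R}}e^{\kappa G} \,dm\leq e^{\kappa\Phi(m,F,G)}. \] In particular, when $m=\gamma_1$ (so that $\kappa=1$), setting \[ \Phi(F,G):=\Phi(\gamma_1,F,G)=-\alpha_{\gamma_1,G}\mathrm{bar}(\mu_F)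 - \alpha_{\gamma_1,F}\mathrm{bar}(\mu_G) + \alpha_{\gamma_1,F}\alpha_{\gamma_1,G}, \] if $F(x) + G(y) \leq (x-y)^2/2$ holds for any $(x,y)\in \mathbb{R}\times\mathbb{R}$, then \[ \int_{\mathbb{R}}e^{F} \,d\gamma_1\int_{\mathbb{R}}e^{G} \,d\gamma_1\leq \exp\left( \min\{\Phi(F,G),-\mathrm{bar}(\mu_F)\mathrm{bar}(\mu_G)\}\right). \]
   Context: $\mathcal{L}^1$ is the Lebesgue measure on $\mathbb{R}$; $\gamma_1$ is the standard Gaussian measure on $\mathbb{R}$. A smooth $V$ is $\kappa$-convex iff $V''\ge\kappa$. $\mathrm{bar}(\mu)=\int x\,d\mu(x)$. $\xi_m$ denotes the unique point at which the density of $m$ attains its maximum (here $\xi_m=0$). For a probability measure $\mu$ on $\mathbb{R}$, $\alpha_{m,\mu}:=T(\xi_m)$, where $T$ is the optimal transport map from $m$ to $\mu$, i.e. the monotone map $T=H^{-1}\circ E$ with $E(x)=m((-\infty,x])$, $H(x)=\mu((-\infty,x])$ and $H^{-1}(s)=\inf\{y\in\mathbb{R}: H(y)>s\}$ for $s\in(0,1)$. *)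

theory Defs
  imports "HOL-Probability.Probability"
begin

definition smooth :: "(real \<Rightarrow> real) \<Rightarrow> bool" where
  "smooth V \<longleftrightarrow> (\<forall>n x. (deriv ^^ n) V field_differentiable (at x))"

definition kappa_convex :: "real \<Rightarrow> (real \<Rightarrow> real) \<Rightarrow> bool" where
  "kappa_convex \<kappa> V \<longleftrightarrow> (\<forall>x. \<kappa> \<le> deriv (deriv V) x)"

definition gibbs_measure :: "(real \<Rightarrow> real) \<Rightarrow> real measure" where
  "gibbs_measure V = density lborel (\<lambda>x. ennreal (exp (- V x)))"

definition std_gaussian :: "real measure" where
  "std_gaussian = density lborel (\<lambda>x. ennreal (std_normal_density x))"

definition bar :: "real measure \<Rightarrow> real" where
  "bar \<mu> = (LINT x|\<mu>. x)"

text \<open>The density of \<open>m\<close> is only determined almost everywhere; the point of maximum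
  refers to its continuous version, which is unique.\<close>

definition mode :: "real measure \<Rightarrow> real" where
  "mode m = (THE \<xi>. \<exists>p. continuous_on UNIV p \<and> (\<forall>y. 0 \<le> p y) \<and>
       m = density lborel (\<lambda>y. ennreal (p y)) \<and> (\<forall>y. p y \<le> p \<xi>))"

definition cdf_inverse :: "real measure \<Rightarrow> real \<Rightarrow> real" where
  "cdf_inverse \<mu> s = Inf {y. cdf \<mu> y > s}"

definition transport_map :: "real measure \<Rightarrow> real measure \<Rightarrow> real \<Rightarrow> real" where
  "transport_map m \<mu> = cdf_inverse \<mu> \<circ> cdf m"

definition alpha :: "real measure \<Rightarrow> real measure \<Rightarrow> real" where
  "alpha m \<mu> = transport_map m \<mu> (mode m)"

text \<open>The functions \<open>F\<close> and \<open>G\<close> may be extended-valued (so that \<open>exp (\<kappa> F)\<close> may vanish,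
  in which case positivity of its integral is a genuine condition); real-valued functions are
  the case \<open>F = ereal \<circ> f\<close>.\<close>

definition ext_exp :: "ereal \<Rightarrow> ennreal" where
  "ext_exp t = (case t of ereal r \<Rightarrow> ennreal (exp r) | PInfty \<Rightarrow> \<infinity> | MInfty \<Rightarrow> 0)"

definition mass :: "real \<Rightarrow> real measure \<Rightarrow> (real \<Rightarrow> ereal) \<Rightarrow> ennreal" where
  "mass \<kappa> m F = (\<integral>\<^sup>+ x. ext_exp (ereal \<kappa> * F x) \<partial>m)"

definition tilt :: "real \<Rightarrow> real measure \<Rightarrow> (real \<Rightarrow> ereal) \<Rightarrow> real measure" where
  "tilt \<kappa> m F = density m (\<lambda>x. ext_exp (ereal \<kappa> * F x) / mass \<kappa> m F)"

definition admissible :: "real \<Rightarrow> real measure \<Rightarrow> (real \<Rightarrow> ereal) \<Rightarrow> bool" where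
  "admissible \<kappa> m F \<longleftrightarrow> F \<in> borel_measurable borel \<and>
     0 < mass \<kappa> m F \<and> mass \<kappa> m F < \<infinity> \<and>
     (\<integral>\<^sup>+ x. ennreal (x\<^sup>2) * ext_exp (ereal \<kappa> * F x) \<partial>m) < \<infinity>"

text \<open>With the conventions for \<^typ>\<open>ereal\<close>, \<open>\<infinity> + (- \<infinity>) = \<infinity>\<close>; so if \<open>F\<close> took the value
  \<open>\<infinity>\<close> anywhere, this would fail for every \<open>G\<close>.\<close>

definition cost_dominated :: "(real \<Rightarrow> ereal) \<Rightarrow> (real \<Rightarrow> ereal) \<Rightarrow> bool" where
  "cost_dominated F G \<longleftrightarrow> (\<forall>x y. F x + G y \<le> ereal ((x - y)\<^sup>2 / 2))"

definition Phi :: "real \<Rightarrow> real measure \<Rightarrow> (real \<Rightarrow> ereal) \<Rightarrow> (real \<Rightarrow> ereal) \<Rightarrow> real" where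
  "Phi \<kappa> m F G =
     (let \<alpha>F = alpha m (tilt \<kappa> m F); \<alpha>G = alpha m (tilt \<kappa> m G) in
      - \<alpha>G * bar (tilt \<kappa> m F) - \<alpha>F * bar (tilt \<kappa> m G) + \<alpha>F * \<alpha>G + (\<alpha>F + \<alpha>G) * bar m)"

end

theory Submission
  imports Defs
begin

text \<open>Write \<open>W = V - \<kappa> x\<^sup>2 / 2\<close>, which is convex with minimum at \<open>0\<close>, and let \<open>\<phi>\<close>, \<open>\<psi>\<close> be the
  densities \<open>e\<^sup>\<kappa>\<^sup>F e\<^sup>-\<^sup>V\<close>, \<open>e\<^sup>\<kappa>\<^sup>G e\<^sup>-\<^sup>V\<close>. The cost condition reads
  \<open>\<phi> x \<psi> y \<le> exp (- \<kappa> x y - W x - W y)\<close>. The points \<open>a = \<alpha>\<^sub>F\<close>, \<open>b = \<alpha>\<^sub>G\<close> split \<open>\<mu>\<^sub>F\<close>, \<open>\<mu>\<^sub>G\<close> in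
  the same proportion in which \<open>0\<close> splits \<open>m\<close>. On the half-lines \<open>x > a\<close>, \<open>y > b\<close>, with
  \<open>x = a + s\<close>, \<open>y = b + t\<close>, the tilts \<open>\<phi> x e\<^sup>\<kappa>\<^sup>b\<^sup>x\<close> and \<open>\<psi> y e\<^sup>\<kappa>\<^sup>a\<^sup>y\<close> have product at most
  \<open>exp (\<kappa> a b - \<kappa> s t - 2 W (d + \<surd>(s t)))\<close> with \<open>d = (a + b) / 2\<close>, and the multiplicative
  Prekopa--Leindler inequality bounds the product of their integrals by
  \<open>e\<^sup>\<kappa>\<^sup>a\<^sup>b K(d)\<^sup>2\<close>, where \<open>K(d) = \<integral>\<^sub>r\<^sub>>\<^sub>0 exp (- \<kappa> r\<^sup>2 / 2 - W (d + r))\<close>. By Prekopa--Leindler again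
  \<open>ln K\<close> is concave, so it lies below its tangent at \<open>0\<close>. Jensen's inequality removes the tilts at
  the price of the half-line barycentres. Averaging with the opposite half-lines, weighted by
  their \<open>m\<close>-mass, the boundary terms of the two tangents cancel and \<open>\<Phi>\<close> remains.

  The Gaussian bound by the barycentres is the functional Santalo inequality: it holds
  when one function is translated by a median, and the inequality for a vanishing barycentre
  follows by applying this to the other function and Jensen's inequality.\<close>

subsection \<open>The Prekopa--Leindler inequality on the real line\<close>

text \<open>If \<open>A\<close> is unbounded above, each \<open>A \<inter> {..n}\<close> lies in an
  initial part cut at a point of \<open>A\<close>, and these sets exhaust \<open>A\<close>. If
  \<open>A\<close> is bounded above, a similar exhaustion reaches everything except possibly
  \<open>Sup A\<close>, a null set. This makes up for a largest element that \<open>A\<close> may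
  fail to have.\<close>

lemma emeasure_le_of_initial_parts:
  fixes A :: "real set"
  assumes A[measurable]: "A \<in> sets borel"
    and le: "\<And>a. a \<in> A \<Longrightarrow> emeasure lborel (A \<inter> {..a}) \<le> c"
  shows "emeasure lborel A \<le> c"
proof -
  have step: "emeasure lborel (A \<inter> {..u}) \<le> c" if "a \<in> A" "u \<le> a" for a u
    using le[OF that(1)] that(2)
    by (intro order_trans[OF emeasure_mono le[OF that(1)]]) auto
  show ?thesis
  proof (cases "bdd_above A")
    case False
    have "emeasure lborel A = emeasure lborel (\<Union>n. A \<inter> {..real n})"
      by (rule arg_cong[where f="emeasure lborel"]) (auto simp: real_arch_simple)
    also have "\<dots> = (SUP n. emeasure lborel (A \<inter> {..real n}))"
      by (rule SUP_emeasure_incseq[symmetric]) (auto simp: incseq_def)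
    also have "\<dots> \<le> c"
    proof (rule SUP_least)
      fix n :: nat
      obtain a where "a \<in> A" "real n \<le> a"
        using False unfolding bdd_above_def by (meson linear)
      then show "emeasure lborel (A \<inter> {..real n}) \<le> c" by (rule step)
    qed
    finally show ?thesis .
  next
    case True
    show ?thesis
    proof (cases "A = {}")
      case False
      define s where "s = Sup A"
      have le_s: "a \<le> s" if "a \<in> A" for a
        unfolding s_def using True that by (rule cSup_upper[rotated])
      have U: "(\<Union>n. A \<inter> {..s - 1 / real (Suc n)}) = A - {s}"
      proof (intro set_eqI iffI)
        fix x assume "x \<in> A - {s}"
        then have "x \<in> A" "x < s" using le_s[of x] by auto
        moreover obtain n where "1 / real (Suc n) < s - x"
          using reals_Archimedean[of "s - x"] \<open>x < s\<close> by (auto simp: inverse_eq_divide)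
        ultimately show "x \<in> (\<Union>n. A \<inter> {..s - 1 / real (Suc n)})"
          by (auto intro!: exI[of _ n])
      next
        fix x assume "x \<in> (\<Union>n. A \<inter> {..s - 1 / real (Suc n)})"
        then obtain n where "x \<in> A" "x \<le> s - 1 / real (Suc n)" by auto
        moreover have "1 / real (Suc n) > 0" by simp
        ultimately have "x < s" by linarith
        with \<open>x \<in> A\<close> show "x \<in> A - {s}" by auto
      qed
      have "emeasure lborel A \<le> emeasure lborel ((A - {s}) \<union> {s})"
        by (rule emeasure_mono) auto
      also have "\<dots> \<le> emeasure lborel (A - {s}) + emeasure lborel {s}"
        by (rule emeasure_subadditive) auto
      also have "\<dots> = emeasure lborel (\<Union>n. A \<inter> {..s - 1 / real (Suc n)})"
        using U by simp
      also have "\<dots> = (SUP n. emeasure lborel (A \<inter> {..s - 1 / real (Suc n)}))"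
      proof (rule SUP_emeasure_incseq[symmetric])
        show "incseq (\<lambda>n. A \<inter> {..s - 1 / real (Suc n)})"
        proof (rule incseq_SucI, safe)
          fix n x assume "x \<le> s - 1 / real (Suc n)"
          moreover have "1 / real (Suc (Suc n)) \<le> 1 / real (Suc n)"
            by (simp add: frac_le)
          ultimately show "x \<le> s - 1 / real (Suc (Suc n))" by linarith
        qed
      qed auto
      also have "\<dots> \<le> c"
      proof (rule SUP_least)
        fix n :: nat
        have "s - 1 / real (Suc n) < Sup A" unfolding s_def by simp
        then obtain a where "a \<in> A" "s - 1 / real (Suc n) < a"
          using False less_cSupE by blast
        then show "emeasure lborel (A \<inter> {..s - 1 / real (Suc n)}) \<le> c" by (intro step) auto
      qed
      finally show ?thesis .
    qed simp
  qed
qed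

lemma emeasure_lborel_affine_preimage:
  fixes A :: "real set"
  assumes [measurable]: "A \<in> sets borel" and c: "c \<noteq> 0"
  shows "emeasure lborel A = ennreal \<bar>c\<bar> * emeasure lborel {x. t + c * x \<in> A}"
proof -
  have "emeasure lborel A = (\<integral>\<^sup>+x. indicator A x \<partial>lborel)" by simp
  also have "\<dots> = ennreal \<bar>c\<bar> * (\<integral>\<^sup>+x. indicator A (t + c * x) \<partial>lborel)"
    by (rule nn_integral_real_affine) (use c in auto)
  also have "(\<integral>\<^sup>+x. indicator A (t + c * x) \<partial>lborel) = (\<integral>\<^sup>+x. indicator {x. t + c * x \<in> A} x \<partial>lborel)"
    by (rule nn_integral_cong) (auto simp: indicator_def)
  also have "\<dots> = emeasure lborel {x. t + c * x \<in> A}"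
    by (rule nn_integral_indicator) auto
  finally show ?thesis .
qed

text \<open>For \<open>a \<in> A\<close> and \<open>b \<in> B\<close> the sumset contains the translates \<open>b + (A \<inter> {..a})\<close> and
  \<open>a + (B \<inter> {b..})\<close>, which share only the point \<open>a + b\<close>.\<close>

lemma brunn_minkowski_real:
  fixes A B C :: "real set"
  assumes [measurable]: "A \<in> sets borel" "B \<in> sets borel" "C \<in> sets borel"
    and ne: "A \<noteq> {}" "B \<noteq> {}"
    and sub: "\<And>a b. a \<in> A \<Longrightarrow> b \<in> B \<Longrightarrow> a + b \<in> C"
  shows "emeasure lborel A + emeasure lborel B \<le> emeasure lborel C"
proof (cases "emeasure lborel C = \<infinity>")
  case False
  \<comment> \<open>Reflecting \<open>B\<close> turns its final parts into initial parts, so one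
    exhaustion lemma serves both sets.\<close>
  define B' where "B' = {x. 0 + (-1) * x \<in> B}"
  have [measurable]: "B' \<in> sets borel" unfolding B'_def by measurable
  have B': "emeasure lborel B' = emeasure lborel B"
    unfolding B'_def by (subst emeasure_lborel_affine_preimage[of B "-1" 0]) auto
  have key: "emeasure lborel (A \<inter> {..a}) + emeasure lborel (B' \<inter> {..b}) \<le> emeasure lborel C"
    if a: "a \<in> A" and b: "b \<in> B'" for a b
  proof -
    have "-b \<in> B" using b by (simp add: B'_def)
    define P where "P = {x. b + 1 * x \<in> A \<inter> {..a}}"
    define Q where "Q = {x. a + (-1) * x \<in> B' \<inter> {..b}}"
    have [measurable]: "P \<in> sets borel" "Q \<in> sets borel" unfolding P_def Q_def by measurable
    have P: "emeasure lborel (A \<inter> {..a}) = emeasure lborel P"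
      unfolding P_def by (subst emeasure_lborel_affine_preimage[of _ 1 b]) auto
    have Q: "emeasure lborel (B' \<inter> {..b}) = emeasure lborel Q"
      unfolding Q_def by (subst emeasure_lborel_affine_preimage[of _ "-1" a]) auto
    have "P \<subseteq> C"
    proof
      fix x assume "x \<in> P"
      then have "b + x \<in> A" by (auto simp: P_def)
      from sub[OF this \<open>-b \<in> B\<close>] show "x \<in> C" by simp
    qed
    moreover have "Q \<subseteq> C"
    proof
      fix x assume "x \<in> Q"
      then have "x - a \<in> B" by (auto simp: Q_def B'_def)
      from sub[OF a this] show "x \<in> C" by simp
    qed
    \<comment> \<open>\<open>P\<close> is the part of \<open>A - b\<close> up to
      \<open>a - b\<close>, and \<open>Q\<close> is the part of \<open>a + B\<close> from
      \<open>a - b\<close> on.\<close>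
    moreover have "P \<inter> Q \<subseteq> {a - b}" by (auto simp: P_def Q_def)
    then have "emeasure lborel (P \<inter> Q) \<le> emeasure lborel {a - b}"
      by (intro emeasure_mono) auto
    then have "emeasure lborel (P \<inter> Q) = 0" by simp
    then have "emeasure lborel (Q - P) = emeasure lborel Q"
      by (subst emeasure_Diff_null_set[of "P \<inter> Q" lborel Q, symmetric])
        (auto intro!: arg_cong[where f="emeasure lborel"])
    then have "emeasure lborel P + emeasure lborel Q = emeasure lborel (P \<union> (Q - P))"
      by (subst plus_emeasure[symmetric]) auto
    ultimately show ?thesis
      unfolding P Q by (auto intro!: emeasure_mono)
  qed
  \<comment> \<open>The cuts are removed one at a time, first \<open>a\<close> with \<open>b\<close>
    fixed, then \<open>b\<close>. Each time the other summand is moved across by subtraction, which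
    requires it to be finite.\<close>
  have step: "emeasure lborel A + emeasure lborel (B' \<inter> {..b}) \<le> emeasure lborel C"
    if b: "b \<in> B'" for b
  proof -
    obtain a0 where "a0 \<in> A" using ne by auto
    have "emeasure lborel (B' \<inter> {..b}) \<le> emeasure lborel C"
      by (rule order_trans[OF _ key[OF \<open>a0 \<in> A\<close> b]]) simp
    then have fin: "emeasure lborel (B' \<inter> {..b}) \<noteq> \<infinity>" using False by (auto simp: top_unique)
    have "emeasure lborel A \<le> emeasure lborel C - emeasure lborel (B' \<inter> {..b})"
      by (rule emeasure_le_of_initial_parts) (use key[OF _ b] fin in \<open>auto simp: ennreal_le_minus_iff add.commute\<close>)
    from add_right_mono[OF this, of "emeasure lborel (B' \<inter> {..b})"] show ?thesis
      unfolding diff_add_cancel_ennreal[OF \<open>emeasure lborel (B' \<inter> {..b}) \<le> emeasure lborel C\<close>] .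
  qed
  have "B' \<noteq> {}" using ne(2) 
  proof -
    obtain b where "b \<in> B" using ne by auto
    then have "- b \<in> B'" by (simp add: B'_def)
    then show ?thesis by auto
  qed
  then obtain b0 where "b0 \<in> B'" by auto
  have "emeasure lborel A \<le> emeasure lborel C"
    by (rule order_trans[OF _ step[OF \<open>b0 \<in> B'\<close>]]) simp
  then have fin: "emeasure lborel A \<noteq> \<infinity>" using False by (auto simp: top_unique)
  have "emeasure lborel B' \<le> emeasure lborel C - emeasure lborel A"
    by (rule emeasure_le_of_initial_parts) (use step fin in \<open>auto simp: ennreal_le_minus_iff add.commute\<close>)
  have "emeasure lborel A + emeasure lborel B \<le> emeasure lborel A + (emeasure lborel C - emeasure lborel A)"
    using \<open>emeasure lborel B' \<le> _\<close> unfolding B' by (rule add_left_mono)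
  also have "\<dots> = emeasure lborel C"
    using diff_add_cancel_ennreal[OF \<open>emeasure lborel A \<le> emeasure lborel C\<close>] by (simp add: add.commute)
  finally show ?thesis .
qed simp

text \<open>The positive part of \<open>min 1 (f x)\<close> is the length of the set of levels in
  the unit interval below \<open>f x\<close>; Tonelli exchanges levels and points. Negative values
  are sent to 0 by \<open>ennreal\<close>.\<close>

lemma nn_integral_layer_cake_unit:
  fixes f :: "real \<Rightarrow> real"
  assumes [measurable]: "f \<in> borel_measurable borel"
  shows "(\<integral>\<^sup>+x. ennreal (min 1 (f x)) \<partial>lborel)
    = (\<integral>\<^sup>+t. emeasure lborel {x. t < f x} * indicator {0<..<1} t \<partial>lborel)"
proof -
  have "(\<integral>\<^sup>+x. ennreal (min 1 (f x)) \<partial>lborel)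
      = (\<integral>\<^sup>+x. \<integral>\<^sup>+t. indicator {x. t < f x} x * indicator {0<..<1} t \<partial>lborel \<partial>lborel)"
  proof (rule nn_integral_cong)
    fix x :: real
    have "(\<integral>\<^sup>+t. indicator {x. t < f x} x * indicator {0<..<1} t \<partial>lborel)
        = (\<integral>\<^sup>+t. indicator {0<..<min 1 (f x)} t \<partial>lborel)"
      by (rule nn_integral_cong) (auto simp: indicator_def)
    also have "\<dots> = ennreal (min 1 (f x))"
      by (cases "0 \<le> f x") (auto simp: ennreal_neg)
    finally show "ennreal (min 1 (f x)) = (\<integral>\<^sup>+t. indicator {x. t < f x} x * indicator {0<..<1} t \<partial>lborel)" ..
  qed
  also have "\<dots> = (\<integral>\<^sup>+t. \<integral>\<^sup>+x. indicator {x. t < f x} x * indicator {0<..<1} t \<partial>lborel \<partial>lborel)"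
  proof (rule lborel_pair.Fubini')
    have "(\<lambda>(t, x). indicator {p. fst p < f (snd p)} (t, x) * indicator {0<..<1} t :: ennreal)
        \<in> borel_measurable (borel \<Otimes>\<^sub>M borel)"
      by measurable
    then show "(\<lambda>(t, x). indicator {x. t < f x} x * indicator {0<..<1} t :: ennreal)
        \<in> borel_measurable (lborel \<Otimes>\<^sub>M lborel)"
      by (simp add: indicator_def cong: measurable_cong_sets)
  qed
  also have "\<dots> = (\<integral>\<^sup>+t. emeasure lborel {x. t < f x} * indicator {0<..<1} t \<partial>lborel)"
    by (rule nn_integral_cong, subst nn_integral_multc) auto
  finally show ?thesis .
qed

text \<open>At each level strictly between 0 and 1 the superlevel sets of \<open>f\<close> and
  \<open>g\<close> are nonempty and their sumset lies in that of \<open>h\<close>. Brunn-Minkowski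
  at every level, integrated over the levels, gives the claim.\<close>

lemma sum_le_nn_integral_of_min_le:
  fixes f g h :: "real \<Rightarrow> real"
  assumes [measurable]: "f \<in> borel_measurable borel" "g \<in> borel_measurable borel" "h \<in> borel_measurable borel"
    and f1: "\<And>x. f x \<le> 1" and g1: "\<And>x. g x \<le> 1"
    and fsup: "\<And>t. 0 < t \<Longrightarrow> t < 1 \<Longrightarrow> \<exists>x. t < f x" and gsup: "\<And>t. 0 < t \<Longrightarrow> t < 1 \<Longrightarrow> \<exists>x. t < g x"
    and le: "\<And>x y. min (f x) (g y) \<le> h (x + y)"
  shows "(\<integral>\<^sup>+x. ennreal (f x) \<partial>lborel) + (\<integral>\<^sup>+x. ennreal (g x) \<partial>lborel) \<le> (\<integral>\<^sup>+x. ennreal (h x) \<partial>lborel)"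
proof -
  define L where "L u = (\<lambda>t. emeasure lborel {x. t < u x} * indicator {0<..<1} t)" for u :: "real \<Rightarrow> real"
  have [measurable]: "L u \<in> borel_measurable borel" if [measurable]: "u \<in> borel_measurable borel" for u
  proof -
    have "{x \<in> space (borel \<Otimes>\<^sub>M lborel). fst x < u (snd x)} \<in> sets (borel \<Otimes>\<^sub>M lborel)"
      by measurable
    then have "{x :: real \<times> real. fst x < u (snd x)} \<in> sets (borel \<Otimes>\<^sub>M lborel)"
      by (simp add: space_pair_measure)
    then have "(\<lambda>t. emeasure lborel (Pair t -` {x. fst x < u (snd x)})) \<in> borel_measurable borel"
      by (rule sigma_finite_measure.measurable_emeasure_Pair[OF sigma_finite_lborel])
    then show ?thesis unfolding L_def by (simp add: vimage_def)
  qed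
  have "(\<integral>\<^sup>+x. ennreal (f x) \<partial>lborel) + (\<integral>\<^sup>+x. ennreal (g x) \<partial>lborel)
      = (\<integral>\<^sup>+t. L f t \<partial>lborel) + (\<integral>\<^sup>+t. L g t \<partial>lborel)"
    using nn_integral_layer_cake_unit[of f] nn_integral_layer_cake_unit[of g] f1 g1
    by (simp add: L_def min_def antisym_conv)
  also have "\<dots> = (\<integral>\<^sup>+t. L f t + L g t \<partial>lborel)"
    by (rule nn_integral_add[symmetric]) auto
  also have "\<dots> \<le> (\<integral>\<^sup>+t. L h t \<partial>lborel)"
  proof (rule nn_integral_mono)
    fix t :: real
    show "L f t + L g t \<le> L h t"
    proof (cases "0 < t \<and> t < 1")
      case True
      have "emeasure lborel {x. t < f x} + emeasure lborel {x. t < g x} \<le> emeasure lborel {x. t < h x}"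
      proof (rule brunn_minkowski_real)
        fix x y assume "x \<in> {x. t < f x}" "y \<in> {x. t < g x}"
        then have "t < min (f x) (g y)" by simp
        then show "x + y \<in> {x. t < h x}" using less_le_trans[OF _ le] by blast
      qed (use True fsup gsup in auto)
      then show ?thesis using True by (simp add: L_def)
    qed (auto simp: L_def)
  qed
  also have "\<dots> = (\<integral>\<^sup>+x. ennreal (min 1 (h x)) \<partial>lborel)"
    using nn_integral_layer_cake_unit[of h] by (simp add: L_def)
  also have "\<dots> \<le> (\<integral>\<^sup>+x. ennreal (h x) \<partial>lborel)"
    by (intro nn_integral_mono ennreal_leI) auto
  finally show ?thesis .
qed

text \<open>After scaling \<open>f\<close> and \<open>g\<close> to supremum 1 the additive
  inequality for \<open>min\<close> applies, and the weighted arithmetic-geometric mean inequality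
  returns the product. The numbers \<open>A\<close> and \<open>B\<close> are finite lower bounds of
  the integrals, so infinite integrals are covered.\<close>

theorem prekopa_leindler_real:
  fixes f g h :: "real \<Rightarrow> real" and l A B C :: real
  assumes [measurable]: "f \<in> borel_measurable borel" "g \<in> borel_measurable borel" "h \<in> borel_measurable borel"
    and l: "0 < l" "l < 1"
    and f0: "\<And>x. 0 \<le> f x" and g0: "\<And>x. 0 \<le> g x"
    and hC: "\<And>x. h x \<le> C"
    and le: "\<And>x y. f x powr (1 - l) * g y powr l \<le> h ((1 - l) * x + l * y)"
    and A: "0 \<le> A" "ennreal A \<le> (\<integral>\<^sup>+x. ennreal (f x) \<partial>lborel)"
    and B: "0 \<le> B" "ennreal B \<le> (\<integral>\<^sup>+x. ennreal (g x) \<partial>lborel)"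
  shows "ennreal (A powr (1 - l) * B powr l) \<le> (\<integral>\<^sup>+x. ennreal (h x) \<partial>lborel)"
proof (cases "A = 0 \<or> B = 0")
  case True
  then show ?thesis using l by auto
next
  case False
  then have Ap: "A > 0" and Bp: "B > 0" using A B by auto
  have pos: "\<exists>x. 0 < u x" if "ennreal E \<le> (\<integral>\<^sup>+x. ennreal (u x) \<partial>lborel)" "E > 0"
    for u :: "real \<Rightarrow> real" and E
  proof (rule ccontr)
    assume "\<nexists>x. 0 < u x"
    then have "(\<integral>\<^sup>+x. ennreal (u x) \<partial>lborel) = (\<integral>\<^sup>+(x::real). 0 \<partial>lborel)"
      by (intro nn_integral_cong) (auto simp: ennreal_neg not_less)
    with that show False by simp
  qed
  obtain x0 where x0: "0 < f x0" using pos[OF A(2) Ap] by auto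
  obtain y0 where y0: "0 < g y0" using pos[OF B(2) Bp] by auto
  \<comment> \<open>Fixing a point where one function is positive, the bound \<open>C\<close> on
    \<open>h\<close> bounds the other function.\<close>
  have bdd: "bdd_above (range u)"
    if u: "\<And>x. 0 \<le> u x" and c: "c > 0" and e: "e > 0" and b: "\<And>x. u x powr e * c \<le> C" for u :: "real \<Rightarrow> real" and c e
  proof (rule bdd_aboveI2)
    fix x
    have "u x powr e \<le> C / c" using b[of x] c by (simp add: field_simps)
    then have "(u x powr e) powr (1/e) \<le> (C / c) powr (1/e)"
      using e by (intro powr_mono2) auto
    then show "u x \<le> (C / c) powr (1/e)" using e u[of x] by (simp add: powr_powr)
  qed
  have fb: "bdd_above (range f)"
  proof (rule bdd[where c="g y0 powr l" and e="1-l"])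
    show "f x powr (1 - l) * g y0 powr l \<le> C" for x
      by (rule order_trans[OF le hC])
  qed (use f0 y0 l in auto)
  have gb: "bdd_above (range g)"
  proof (rule bdd[where c="f x0 powr (1-l)" and e="l"])
    show "g x powr l * f x0 powr (1 - l) \<le> C" for x
      using order_trans[OF le[of x0 x] hC] by (simp add: mult.commute)
  qed (use g0 x0 l in auto)
  define a where "a = Sup (range f)"
  define b where "b = Sup (range g)"
  have fa: "f x \<le> a" for x unfolding a_def by (intro cSup_upper fb) auto
  have gb': "g x \<le> b" for x unfolding b_def by (intro cSup_upper gb) auto
  have a: "a > 0" using fa[of x0] x0 by linarith
  have b: "b > 0" using gb'[of y0] y0 by linarith
  define c where "c = a powr (1 - l) * b powr l"
  have c: "c > 0" using a b by (simp add: c_def)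
  \<comment> \<open>Dividing by the suprema normalises the values; stretching the arguments by
    \<open>1 - l\<close> and \<open>l\<close> turns the convex combination into the plain sum
    \<open>x + y\<close>.\<close>
  define f' where "f' x = f (0 + (1 / (1 - l)) * x) / a" for x
  define g' where "g' x = g (0 + (1 / l) * x) / b" for x
  have [measurable]: "f' \<in> borel_measurable borel" "g' \<in> borel_measurable borel"
    unfolding f'_def g'_def by measurable
  have If: "(\<integral>\<^sup>+x. ennreal (f' x) \<partial>lborel) \<ge> ennreal ((1 - l) * (A / a))"
  proof -
    have "ennreal (A / a) \<le> (\<integral>\<^sup>+x. ennreal (f x) \<partial>lborel) / ennreal a"
      using A(2) a Ap by (simp add: divide_ennreal[symmetric] divide_right_mono_ennreal)
    also have "\<dots> = (\<integral>\<^sup>+x. ennreal (f x / a) \<partial>lborel)"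
      using a f0 by (simp add: nn_integral_divide divide_ennreal[symmetric])
    also have "\<dots> = ennreal \<bar>1 / (1 - l)\<bar> * (\<integral>\<^sup>+x. ennreal (f' x) \<partial>lborel)"
      unfolding f'_def by (rule nn_integral_real_affine) (use l in auto)
    finally have "ennreal (1 - l) * ennreal (A / a) \<le> ennreal (1 - l) * (ennreal \<bar>1 / (1 - l)\<bar> * (\<integral>\<^sup>+x. ennreal (f' x) \<partial>lborel))"
      by (rule mult_left_mono) simp
    then show ?thesis using l Ap a
      by (simp add: mult.assoc[symmetric] ennreal_mult[symmetric] del: ennreal_1) simp
  qed
  have Ig: "(\<integral>\<^sup>+x. ennreal (g' x) \<partial>lborel) \<ge> ennreal (l * (B / b))"
  proof -
    have "ennreal (B / b) \<le> (\<integral>\<^sup>+x. ennreal (g x) \<partial>lborel) / ennreal b"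
      using B(2) b Bp by (simp add: divide_ennreal[symmetric] divide_right_mono_ennreal)
    also have "\<dots> = (\<integral>\<^sup>+x. ennreal (g x / b) \<partial>lborel)"
      using b g0 by (simp add: nn_integral_divide divide_ennreal[symmetric])
    also have "\<dots> = ennreal \<bar>1 / l\<bar> * (\<integral>\<^sup>+x. ennreal (g' x) \<partial>lborel)"
      unfolding g'_def by (rule nn_integral_real_affine) (use l in auto)
    finally have "ennreal l * ennreal (B / b) \<le> ennreal l * (ennreal \<bar>1 / l\<bar> * (\<integral>\<^sup>+x. ennreal (g' x) \<partial>lborel))"
      by (rule mult_left_mono) simp
    then show ?thesis using l Bp b
      by (simp add: mult.assoc[symmetric] ennreal_mult[symmetric] del: ennreal_1) simp
  qed
  have "ennreal ((1 - l) * (A / a)) + ennreal (l * (B / b)) \<le> (\<integral>\<^sup>+x. ennreal (h x / c) \<partial>lborel)"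
  proof (rule order_trans[OF add_mono[OF If Ig] sum_le_nn_integral_of_min_le])
    show "f' x \<le> 1" "g' x \<le> 1" for x using fa gb' a b by (auto simp: f'_def g'_def)
    fix t :: real assume t: "0 < t" "t < 1"
    have "t * a < a" "t * b < b" using t a b by auto
    then obtain x y where xy: "t * a < f x" "t * b < g y"
      unfolding a_def b_def using less_cSup_iff[OF _ fb] less_cSup_iff[OF _ gb] by auto
    show "\<exists>x. t < f' x" by (rule exI[of _ "(1-l)*x"]) (use xy l a in \<open>simp add: f'_def pos_less_divide_eq\<close>)
    show "\<exists>x. t < g' x" by (rule exI[of _ "l*y"]) (use xy l b in \<open>simp add: g'_def pos_less_divide_eq\<close>)
  next
    fix x y :: real
    have f'0: "0 \<le> f' x" and g'0: "0 \<le> g' y" using f0 g0 a b by (auto simp: f'_def g'_def)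
    define m where "m = min (f' x) (g' y)"
    have m: "0 \<le> m" using f'0 g'0 by (simp add: m_def)
    \<comment> \<open>The minimum equals its own weighted geometric mean, which lies below that of
      the two values.\<close>
    have "m = m powr (1 - l) * m powr l" using m by (simp add: powr_add[symmetric])
    also have "\<dots> \<le> f' x powr (1 - l) * g' y powr l"
      using m l by (intro mult_mono powr_mono2) (auto simp: m_def)
    also have "\<dots> = f (x / (1 - l)) powr (1 - l) * g (y / l) powr l / c"
      using a b f0 g0 by (simp add: f'_def g'_def c_def powr_divide)
    also have "\<dots> \<le> h ((1 - l) * (x / (1 - l)) + l * (y / l)) / c"
      by (rule divide_right_mono[OF le]) (use c in simp)
    also have "\<dots> = h (x + y) / c" using l by simp
    finally show "min (f' x) (g' y) \<le> h (x + y) / c" by (simp add: m_def)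
  qed simp_all
  \<comment> \<open>Weighted arithmetic-geometric mean inequality for the normalised masses; the
    factor \<open>c\<close> then restores the suprema.\<close>
  moreover have "(A / a) powr (1 - l) * (B / b) powr l \<le> (1 - l) * (A / a) + l * (B / b)"
    by (rule Youngs_inequality_0) (use l Ap Bp a b in auto)
  then have "ennreal (A powr (1 - l) * B powr l / c) \<le> ennreal ((1 - l) * (A / a)) + ennreal (l * (B / b))"
    using l Ap Bp a b
    by (subst ennreal_plus[symmetric]) (auto simp: c_def powr_divide simp del: ennreal_plus intro!: ennreal_leI)
  ultimately have "ennreal (A powr (1 - l) * B powr l / c) \<le> (\<integral>\<^sup>+x. ennreal (h x / c) \<partial>lborel)"
    by (rule order_trans[rotated])
  then have "ennreal c * ennreal (A powr (1 - l) * B powr l / c) \<le> ennreal c * (\<integral>\<^sup>+x. ennreal (h x / c) \<partial>lborel)"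
    by (rule mult_left_mono) simp
  then show ?thesis
    using c by (simp add: nn_integral_cmult[symmetric] ennreal_mult'[symmetric])
qed

section \<open>The multiplicative form on the half-line\<close>

lemma nn_integral_exp_substitution:
  fixes f :: "real \<Rightarrow> real"
  assumes [measurable]: "f \<in> borel_measurable borel" and f0: "\<And>x. 0 \<le> f x"
  shows "(\<integral>\<^sup>+x. ennreal (f x * indicator {0<..} x) \<partial>lborel) = (\<integral>\<^sup>+u. ennreal (f (exp u) * exp u) \<partial>lborel)"
proof -
  \<comment> \<open>The change of variables is made on compact intervals; monotone convergence on
    both sides then gives the half-line and the whole line.\<close>
  have eq: "(\<integral>\<^sup>+x. ennreal (f x) * indicator {exp (- real n)..exp (real n)} x \<partial>lborel)
     = (\<integral>\<^sup>+u. ennreal (f (exp u) * exp u) * indicator {- real n..real n} u \<partial>lborel)" for n :: nat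
  proof -
    have "continuous_on {- real n..real n} (exp :: real \<Rightarrow> real)" by (intro continuous_intros)
    from nn_integral_substitution[of exp "- real n" "real n" f exp, OF _ _ this]
    show ?thesis
      by (auto simp: set_borel_measurable_def f0 nn_integral_set_ennreal ennreal_mult' ennreal_indicator[symmetric]
        intro!: derivative_eq_intros)
  qed
  have "(\<integral>\<^sup>+x. ennreal (f x * indicator {0<..} x) \<partial>lborel)
     = (\<integral>\<^sup>+x. (SUP n. ennreal (f x) * indicator {exp (- real n)..exp (real n)} x) \<partial>lborel)"
  proof (rule nn_integral_cong)
    fix x :: real
    show "ennreal (f x * indicator {0<..} x) = (SUP n. ennreal (f x) * indicator {exp (- real n)..exp (real n)} x)"
    proof (cases "x > 0")
      case True
      obtain n where n: "\<bar>ln x\<bar> \<le> real n" using real_arch_simple by blast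
      then have "exp (- real n) \<le> exp (ln x)" "exp (ln x) \<le> exp (real n)" unfolding exp_le_cancel_iff by auto
      then have "ennreal (f x) \<le> (SUP n. ennreal (f x) * indicator {exp (- real n)..exp (real n)} x)"
        using True by (intro SUP_upper2[of n]) auto
      then show ?thesis using True
        by (intro antisym SUP_least) (auto simp: indicator_def)
    next
      case False
      then have "x \<notin> {exp (- real n)..exp (real n)}" for n using exp_gt_zero[of "- real n"] by (auto simp del: exp_gt_zero)
      then show ?thesis using False by simp
    qed
  qed
  also have "\<dots> = (SUP n. \<integral>\<^sup>+x. ennreal (f x) * indicator {exp (- real n)..exp (real n)} x \<partial>lborel)"
  proof (rule nn_integral_monotone_convergence_SUP)
    show "incseq (\<lambda>n x. ennreal (f x) * indicator {exp (- real n)..exp (real n)} x)"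
    proof (intro incseq_SucI le_funI mult_left_mono)
      fix n :: nat and x :: real
      have "exp (- real (Suc n)) \<le> exp (- real n)" "exp (real n) \<le> exp (real (Suc n))" unfolding exp_le_cancel_iff by auto
      then show "(indicator {exp (- real n)..exp (real n)} x :: ennreal) \<le> indicator {exp (- real (Suc n))..exp (real (Suc n))} x"
        unfolding indicator_def by (auto simp del: of_nat_Suc exp_le_cancel_iff intro: order_trans)
    qed simp
  qed simp
  also have "\<dots> = (SUP n. \<integral>\<^sup>+u. ennreal (f (exp u) * exp u) * indicator {- real n..real n} u \<partial>lborel)"
    unfolding eq ..
  also have "\<dots> = (\<integral>\<^sup>+u. (SUP n. ennreal (f (exp u) * exp u) * indicator {- real n..real n} u) \<partial>lborel)"
  proof (rule nn_integral_monotone_convergence_SUP[symmetric])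
    show "incseq (\<lambda>n u. ennreal (f (exp u) * exp u) * indicator {- real n..real n} u)"
      by (intro incseq_SucI le_funI mult_left_mono) (auto simp: indicator_def)
  qed simp
  also have "\<dots> = (\<integral>\<^sup>+u. ennreal (f (exp u) * exp u) \<partial>lborel)"
  proof (rule nn_integral_cong)
    fix u :: real
    obtain n where n: "\<bar>u\<bar> \<le> real n" using real_arch_simple by blast
    then have "ennreal (f (exp u) * exp u) \<le> (SUP n. ennreal (f (exp u) * exp u) * indicator {- real n..real n} u)"
      by (intro SUP_upper2[of n]) (auto simp: abs_le_iff)
    then show "(SUP n. ennreal (f (exp u) * exp u) * indicator {- real n..real n} u) = ennreal (f (exp u) * exp u)"
      by (intro antisym SUP_least) (auto simp: indicator_def)
  qed
  finally show ?thesis .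
qed

text \<open>In the coordinates \<open>s = exp u\<close> and \<open>t = exp v\<close> the geometric
  mean becomes the arithmetic mean of the exponents. The Jacobians \<open>exp u\<close> and
  \<open>exp v\<close> have geometric mean \<open>exp ((u + v) / 2)\<close>, the Jacobian on the
  side of \<open>H\<close>, so the additive form with weight 1/2 applies.\<close>

lemma prekopa_leindler_geometric:
  fixes f g H :: "real \<Rightarrow> real" and A B C :: real
  assumes [measurable]: "f \<in> borel_measurable borel" "g \<in> borel_measurable borel" "H \<in> borel_measurable borel"
    and f0: "\<And>x. 0 \<le> f x" and g0: "\<And>x. 0 \<le> g x" and H0: "\<And>x. 0 \<le> H x"
    and HC: "\<And>r. 0 < r \<Longrightarrow> r * H r \<le> C"
    and le: "\<And>s t. 0 < s \<Longrightarrow> 0 < t \<Longrightarrow> f s * g t \<le> (H (sqrt (s * t)))\<^sup>2"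
    and A: "0 \<le> A" "ennreal A \<le> (\<integral>\<^sup>+x. ennreal (f x * indicator {0<..} x) \<partial>lborel)"
    and B: "0 \<le> B" "ennreal B \<le> (\<integral>\<^sup>+x. ennreal (g x * indicator {0<..} x) \<partial>lborel)"
  shows "ennreal (sqrt (A * B)) \<le> (\<integral>\<^sup>+x. ennreal (H x * indicator {0<..} x) \<partial>lborel)"
proof -
  have half: "(1 - 1/2 :: real) = 1/2" by simp
  have "ennreal (A powr (1 - 1/2) * B powr (1/2)) \<le> (\<integral>\<^sup>+u. ennreal (H (exp u) * exp u) \<partial>lborel)"
  proof (rule prekopa_leindler_real[where C=C])
    show "H (exp u) * exp u \<le> C" for u using HC[of "exp u"] by (simp add: mult.commute)
    show "ennreal A \<le> (\<integral>\<^sup>+u. ennreal (f (exp u) * exp u) \<partial>lborel)"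
      using A(2) nn_integral_exp_substitution[of f] f0 by simp
    show "ennreal B \<le> (\<integral>\<^sup>+u. ennreal (g (exp u) * exp u) \<partial>lborel)"
      using B(2) nn_integral_exp_substitution[of g] g0 by simp
    fix u v :: real
    have e: "exp (u/2 + v/2) = sqrt (exp u * exp v)"
      by (rule real_sqrt_unique[symmetric]) (simp_all add: exp_add[symmetric] power2_eq_square)
    have "(f (exp u) * exp u) powr (1 - 1/2) * (g (exp v) * exp v) powr (1/2)
        = sqrt ((f (exp u) * g (exp v)) * (exp u * exp v))"
      unfolding half using f0 g0 by (simp add: powr_half_sqrt real_sqrt_mult[symmetric] mult_ac)
    also have "\<dots> \<le> sqrt ((H (sqrt (exp u * exp v)))\<^sup>2 * (exp u * exp v))"
      by (intro real_sqrt_le_mono mult_right_mono le) auto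
    also have "\<dots> = H (exp (u/2 + v/2)) * exp (u/2 + v/2)"
      unfolding e using H0 by (simp add: real_sqrt_mult)
    finally show "(f (exp u) * exp u) powr (1 - 1/2) * (g (exp v) * exp v) powr (1/2)
        \<le> H (exp ((1 - 1/2) * u + 1/2 * v)) * exp ((1 - 1/2) * u + 1/2 * v)" by simp
  qed (use f0 g0 A B in auto)
  then show ?thesis
    using A B nn_integral_exp_substitution[of H] H0 unfolding half
    by (simp add: powr_half_sqrt real_sqrt_mult)
qed

subsection \<open>Shifted half-line integrals\<close>

lemma abs_le_one_plus_square: "\<bar>x\<bar> \<le> 1 + x\<^sup>2" for x :: real
  using zero_le_power2[of "\<bar>x\<bar> - 1/2"] by (simp add: power2_diff field_simps)

lemma not_AE_notin_interval:
  fixes a b :: real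
  assumes "a < b"
  shows "\<not> (AE x in lborel. x \<notin> {a<..<b})"
proof
  assume "AE x in lborel. x \<notin> {a<..<b}"
  then have "emeasure lborel {a<..<b} = 0"
    by (subst (asm) AE_iff_measurable[OF _ refl]) (auto simp del: greaterThanLessThan_iff)
  then show False using assms by simp
qed

lemma integrable_exp_quadratic:
  fixes k B :: real
  assumes k: "k > 0"
  shows "integrable lborel (\<lambda>r. exp (B * r - k * r\<^sup>2 / 2))"
proof -
  have "integrable lborel (\<lambda>r. sqrt (2 * pi / k) * exp (B\<^sup>2 / (2 * k)) * normal_density (B / k) (1 / sqrt k) r)"
    using k by (intro integrable_mult_right integrable_normal_density) auto
  moreover have "sqrt (2 * pi / k) * exp (B\<^sup>2 / (2 * k)) * normal_density (B / k) (1 / sqrt k) r = exp (B * r - k * r\<^sup>2 / 2)" for r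
  proof -
    have "B\<^sup>2 / (2 * k) + - (r - B / k)\<^sup>2 / (2 * (1 / sqrt k)\<^sup>2) = B * r - k * r\<^sup>2 / 2"
      using k by (simp add: power_divide field_simps power2_eq_square)
    then show ?thesis
      using k by (simp add: normal_density_def power_divide real_sqrt_divide real_sqrt_mult exp_add[symmetric])
  qed
  ultimately show ?thesis by simp
qed

text \<open>The square is dominated by \<open>2 * exp r + 2 * exp (- r)\<close>, which only shifts
  the linear coefficient \<open>B\<close> by one in either direction.\<close>

lemma integrable_square_exp_quadratic:
  fixes k B :: real
  assumes k: "k > 0"
  shows "integrable lborel (\<lambda>r. r\<^sup>2 * exp (B * r - k * r\<^sup>2 / 2))"
proof (rule Bochner_Integration.integrable_bound)
  show "integrable lborel (\<lambda>r. 2 * exp ((B + 1) * r - k * r\<^sup>2 / 2) + 2 * exp ((B - 1) * r - k * r\<^sup>2 / 2))"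
    by (intro Bochner_Integration.integrable_add integrable_mult_right integrable_exp_quadratic k)
  have sq: "r\<^sup>2 \<le> 2 * exp r + 2 * exp (- r)" for r :: real
  proof -
    have "r\<^sup>2 \<le> 2 * exp \<bar>r\<bar>"
      using exp_lower_Taylor_quadratic[OF abs_ge_zero[of r]] abs_ge_zero[of r]
      unfolding power2_abs by linarith
    also have "\<dots> \<le> 2 * exp r + 2 * exp (- r)" by (cases "r \<ge> 0") auto
    finally show ?thesis .
  qed
  show "AE r in lborel. norm (r\<^sup>2 * exp (B * r - k * r\<^sup>2 / 2))
      \<le> norm (2 * exp ((B + 1) * r - k * r\<^sup>2 / 2) + 2 * exp ((B - 1) * r - k * r\<^sup>2 / 2))"
  proof (rule AE_I2)
    fix r :: real
    have "r\<^sup>2 * exp (B * r - k * r\<^sup>2 / 2) \<le> (2 * exp r + 2 * exp (- r)) * exp (B * r - k * r\<^sup>2 / 2)"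
      by (intro mult_right_mono sq) auto
    also have "\<dots> = 2 * exp ((B + 1) * r - k * r\<^sup>2 / 2) + 2 * exp ((B - 1) * r - k * r\<^sup>2 / 2)"
      by (simp add: algebra_simps mult_exp_exp)
    finally show "norm (r\<^sup>2 * exp (B * r - k * r\<^sup>2 / 2))
      \<le> norm (2 * exp ((B + 1) * r - k * r\<^sup>2 / 2) + 2 * exp ((B - 1) * r - k * r\<^sup>2 / 2))" by simp
  qed
qed simp

text \<open>A second-order bound for both signs whose remainder stays integrable against a Gaussian.
  For nonnegative \<open>x\<close> it comes from using \<open>exp x - 1 \<le> x * exp x\<close>
  twice.\<close>

lemma exp_le_quadratic_remainder: "exp x \<le> 1 + x + x\<^sup>2 * exp \<bar>x\<bar>" for x :: real
proof (cases "x \<ge> 0")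
  case True
  have "1 + - x \<le> exp (- x)" by (rule exp_ge_add_one_self)
  then have "(1 - x) * exp x \<le> exp (- x) * exp x" by (intro mult_right_mono) auto
  then have "exp x - 1 \<le> x * exp x" by (simp add: exp_minus algebra_simps)
  moreover from this True have "x * (exp x - 1) \<le> x * (x * exp x)" by (intro mult_left_mono)
  ultimately show ?thesis using True by (simp add: power2_eq_square algebra_simps)
next
  case False
  define y where "y = - x"
  have y: "y > 0" using False by (simp add: y_def)
  have "1 + y \<le> exp y" by (rule exp_ge_add_one_self)
  then have "(1 + y) * exp (-y) \<le> exp y * exp (- y)" by (intro mult_right_mono) auto
  then have a: "exp (-y) + y * exp (-y) \<le> 1" by (simp add: exp_minus algebra_simps)
  have "y * exp (-y) \<ge> y * (1 - y)" using exp_ge_add_one_self[of "-y"] y by (intro mult_left_mono) auto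
  then have "exp (-y) \<le> 1 - y + y\<^sup>2 * 1" using a by (simp add: algebra_simps power2_eq_square)
  also have "\<dots> \<le> 1 - y + y\<^sup>2 * exp y" using y by (intro add_left_mono mult_left_mono) auto
  finally show ?thesis using False by (simp add: y_def)
qed

text \<open>\<open>w\<close> plays the part of \<open>V - \<kappa> x\<^sup>2 / 2\<close> on a half-line, extended by its minimum.\<close>

locale half_line_potential =
  fixes k :: real and w :: "real \<Rightarrow> real"
  assumes k: "k > 0" and w_convex: "convex_on UNIV w" and w_mono: "mono w"
    and w_neg: "\<And>u. u \<le> 0 \<Longrightarrow> w u = w 0"
begin

definition kern :: "real \<Rightarrow> real \<Rightarrow> real" where
  "kern d r = exp (- k * r\<^sup>2 / 2 - w (d + r)) * indicator {0<..} r"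

definition Kint :: "real \<Rightarrow> real" where
  "Kint d = (\<integral>r. kern d r \<partial>lborel)"

text \<open>This moment enters the slope of \<open>Kint\<close> at 0, which is
  \<open>k * Rint - exp (- w 0)\<close>: the Gaussian factor gives the first term, the moving
  endpoint the second.\<close>

definition Rint :: real where
  "Rint = (\<integral>r. r * kern 0 r \<partial>lborel)"

lemma w_ge: "w 0 \<le> w u"
  using w_mono w_neg[of u] by (cases "u \<le> 0") (auto simp: mono_def)

lemma w_borel[measurable]: "w \<in> borel_measurable borel"
  by (rule borel_measurable_mono[OF w_mono])

lemma kern_borel[measurable]: "kern d \<in> borel_measurable borel"
  unfolding kern_def by measurable

lemma kern_nonneg: "0 \<le> kern d r"
  by (simp add: kern_def)

lemma kern_le: "kern d r \<le> exp (- w 0) * exp (0 * r - k * r\<^sup>2 / 2)"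
  using w_ge[of "d + r"] by (auto simp: kern_def mult_exp_exp indicator_def)

lemma kern_le_const: "kern d r \<le> exp (- w 0)"
proof -
  have "exp (0 * r - k * r\<^sup>2 / 2) \<le> 1" using k by simp
  then have "exp (- w 0) * exp (0 * r - k * r\<^sup>2 / 2) \<le> exp (- w 0) * 1" by (intro mult_left_mono) auto
  with kern_le[of d r] show ?thesis by linarith
qed

lemma integrable_kern: "integrable lborel (kern d)"
proof (rule Bochner_Integration.integrable_bound)
  show "integrable lborel (\<lambda>r. exp (- w 0) * exp (0 * r - k * r\<^sup>2 / 2))"
    by (intro integrable_mult_right integrable_exp_quadratic k)
  show "AE r in lborel. norm (kern d r) \<le> norm (exp (- w 0) * exp (0 * r - k * r\<^sup>2 / 2))"
    using kern_le kern_nonneg by (intro AE_I2) (simp add: abs_of_nonneg)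
qed simp

lemma Kint_pos: "0 < Kint d"
proof (rule ccontr)
  assume "\<not> 0 < Kint d"
  moreover have "0 \<le> Kint d" unfolding Kint_def by (intro integral_nonneg_AE AE_I2 kern_nonneg)
  ultimately have "(\<integral>r. kern d r \<partial>lborel) = 0" by (simp add: Kint_def)
  then have "AE r in lborel. kern d r = 0"
    using integral_nonneg_eq_0_iff_AE[OF integrable_kern] kern_nonneg by simp
  then have "AE r in lborel. r \<notin> {0<..<1::real}"
    by (rule eventually_mono) (auto simp: kern_def indicator_def)
  then show False by (simp only: not_AE_notin_interval zero_less_one)
qed

lemma integrable_square_kern: "integrable lborel (\<lambda>r. r\<^sup>2 * exp (B * r) * kern 0 r)"
proof (rule Bochner_Integration.integrable_bound)
  show "integrable lborel (\<lambda>r. exp (- w 0) * (r\<^sup>2 * exp (B * r - k * r\<^sup>2 / 2)))"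
    by (intro integrable_mult_right integrable_square_exp_quadratic k)
  show "AE r in lborel. norm (r\<^sup>2 * exp (B * r) * kern 0 r) \<le> norm (exp (- w 0) * (r\<^sup>2 * exp (B * r - k * r\<^sup>2 / 2)))"
  proof (rule AE_I2)
    fix r :: real
    have "r\<^sup>2 * exp (B * r) * kern 0 r \<le> r\<^sup>2 * exp (B * r) * (exp (- w 0) * exp (0 * r - k * r\<^sup>2 / 2))"
      by (intro mult_left_mono kern_le) auto
    also have "\<dots> = exp (- w 0) * (r\<^sup>2 * exp (B * r - k * r\<^sup>2 / 2))"
      by (simp add: mult_exp_exp mult_ac)
    finally show "norm (r\<^sup>2 * exp (B * r) * kern 0 r) \<le> norm (exp (- w 0) * (r\<^sup>2 * exp (B * r - k * r\<^sup>2 / 2)))"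
      using kern_nonneg[of 0 r] by simp
  qed
qed simp

lemma integrable_ident_kern: "integrable lborel (\<lambda>r. r * kern 0 r)"
proof (rule Bochner_Integration.integrable_bound)
  show "integrable lborel (\<lambda>r. kern 0 r + r\<^sup>2 * exp (0 * r) * kern 0 r)"
    by (intro Bochner_Integration.integrable_add integrable_kern integrable_square_kern)
  show "AE r in lborel. norm (r * kern 0 r) \<le> norm (kern 0 r + r\<^sup>2 * exp (0 * r) * kern 0 r)"
  proof (rule AE_I2)
    fix r :: real
    have "\<bar>r\<bar> \<le> 1 + r\<^sup>2" by (rule abs_le_one_plus_square)
    then have "\<bar>r\<bar> * kern 0 r \<le> (1 + r\<^sup>2) * kern 0 r" by (rule mult_right_mono[OF _ kern_nonneg])
    then show "norm (r * kern 0 r) \<le> norm (kern 0 r + r\<^sup>2 * exp (0 * r) * kern 0 r)"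
      using kern_nonneg[of 0 r] by (simp add: abs_mult algebra_simps)
  qed
qed simp

text \<open>The kernel is jointly log-concave in shift and variable, because \<open>w\<close> and
  the square are convex; Prekopa-Leindler passes this to the integral over \<open>r\<close>.\<close>

lemma Kint_log_concave:
  assumes l: "0 < l" "l < 1"
  shows "Kint 0 powr (1 - l) * Kint d powr l \<le> Kint (l * d)"
proof -
  have e: "ennreal (Kint x) = (\<integral>\<^sup>+r. ennreal (kern x r) \<partial>lborel)" for x
    unfolding Kint_def by (rule nn_integral_eq_integral[symmetric]) (auto simp: integrable_kern kern_nonneg)
  have "ennreal (Kint 0 powr (1 - l) * Kint d powr l) \<le> (\<integral>\<^sup>+r. ennreal (kern (l * d) r) \<partial>lborel)"
  proof (rule prekopa_leindler_real[where C="exp (- w 0)"])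
    fix x y :: real
    show "kern 0 x powr (1 - l) * kern d y powr l \<le> kern (l * d) ((1 - l) * x + l * y)"
    proof (cases "x > 0 \<and> y > 0")
      case True
      then have "(1 - l) * x + l * y > 0" using l by (intro add_pos_pos mult_pos_pos) auto
      have "w (l * d + ((1 - l) * x + l * y)) \<le> (1 - l) * w x + l * w (d + y)"
        using convex_onD[OF w_convex, of l x "d + y"] l by (simp add: algebra_simps)
      moreover have "((1 - l) * x + l * y)\<^sup>2 \<le> (1 - l) * x\<^sup>2 + l * y\<^sup>2"
      proof -
        \<comment> \<open>The defect in the convexity of the square, in closed form.\<close>
        have "(1 - l) * x\<^sup>2 + l * y\<^sup>2 - ((1 - l) * x + l * y)\<^sup>2 = l * (1 - l) * (x - y)\<^sup>2"
          by (simp add: power2_eq_square algebra_simps)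
        then show ?thesis using l by (metis diff_ge_0_iff_ge less_eq_real_def mult_nonneg_nonneg zero_le_power2)
      qed
      then have "k * ((1 - l) * x + l * y)\<^sup>2 \<le> k * ((1 - l) * x\<^sup>2 + l * y\<^sup>2)"
        using k by (intro mult_left_mono) auto
      ultimately have "(1 - l) * (- k * x\<^sup>2 / 2 - w x) + l * (- k * y\<^sup>2 / 2 - w (d + y))
          \<le> - k * ((1 - l) * x + l * y)\<^sup>2 / 2 - w (l * d + ((1 - l) * x + l * y))"
        by (simp add: field_simps)
      then show ?thesis
        using True \<open>(1 - l) * x + l * y > 0\<close> by (simp add: kern_def exp_powr_real mult_exp_exp mult.commute)
    next
      case False
      then have "kern 0 x = 0 \<or> kern d y = 0" by (auto simp: kern_def)
      then have "kern 0 x powr (1 - l) * kern d y powr l = 0" by auto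
      then show ?thesis by (simp only: kern_nonneg)
    qed
  qed (auto simp: l kern_nonneg kern_le_const e less_imp_le[OF Kint_pos])
  then show ?thesis
    unfolding e[symmetric] using Kint_pos[of "l * d"] by simp
qed

text \<open>Translating the variable moves the shift \<open>e\<close> from \<open>w\<close> into the
  quadratic exponent and into the endpoint of integration. The quadratic exponent is expanded to
  second order in \<open>e\<close>, while \<open>w\<close> is never differentiated. The bound
  \<open>D\<close> makes the remainder uniform in \<open>e\<close>.\<close>

lemma Kint_le:
  assumes e: "\<bar>e\<bar> \<le> D"
  shows "Kint e \<le> Kint 0 + e * (k * Rint - exp (- k * (max e 0)\<^sup>2 / 2 - w e))
      + e\<^sup>2 * (\<integral>r. k\<^sup>2 * (r\<^sup>2 * exp (k * D * r) * kern 0 r) \<partial>lborel)"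
proof -
  \<comment> \<open>\<open>s * J\<close> accounts for the interval between 0 and \<open>e\<close>.
    For positive \<open>e\<close> the number \<open>s\<close> is the smallest value of
    \<open>kern 0\<close> there. For negative \<open>e\<close> it equals \<open>exp (- w 0)\<close>,
    which dominates the translated kernel. The signed indicator \<open>J\<close> has integral
    \<open>- e\<close>.\<close>
  define s where "s = exp (- k * (max e 0)\<^sup>2 / 2 - w e)"
  define J where "J r = indicator {e<..0} r - (indicator {0<..e} r :: real)" for r
  have fin: "emeasure lborel {a<..b} < \<infinity>" for a b :: real
    by (cases "a \<le> b") auto
  have Jint: "has_bochner_integral lborel J (- e)"
  proof -
    have "has_bochner_integral lborel J (measure lborel {e<..0} - measure lborel {0<..e})"
      unfolding J_def by (intro has_bochner_integral_diff has_bochner_integral_real_indicator fin) auto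
    then show ?thesis by (cases "e \<ge> 0") auto
  qed
  let ?b = "\<lambda>r. kern 0 r + k * e * (r * kern 0 r) + e\<^sup>2 * (k\<^sup>2 * (r\<^sup>2 * exp (k * D * r) * kern 0 r)) + s * J r"
  have bint: "integrable lborel ?b"
    using Jint by (intro Bochner_Integration.integrable_add integrable_mult_right integrable_kern
      integrable_ident_kern integrable_square_kern) (auto simp: has_bochner_integral_iff)
  have "Kint e = (\<integral>r. kern e (- e + 1 * r) \<partial>lborel)"
    unfolding Kint_def by (subst lborel_integral_real_affine[of 1 _ "- e"]) auto
  also have "\<dots> \<le> (\<integral>r. ?b r \<partial>lborel)"
  proof (rule integral_mono)
    show "integrable lborel (\<lambda>r. kern e (- e + 1 * r))"
      by (rule lborel_integrable_real_affine[OF integrable_kern]) simp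
    show "integrable lborel ?b" by (rule bint)
    fix r :: real
    have main: "exp (- k * (r - e)\<^sup>2 / 2 - w r)
        \<le> exp (- k * r\<^sup>2 / 2 - w r) * (1 + k * e * r + (k * e * r)\<^sup>2 * exp (k * D * r))" if "r > 0"
    proof -
      have "exp (- k * (r - e)\<^sup>2 / 2 - w r) \<le> exp ((- k * r\<^sup>2 / 2 - w r) + k * e * r)"
      proof -
        have "- k * (r - e)\<^sup>2 / 2 = - k * r\<^sup>2 / 2 + k * e * r - k * e\<^sup>2 / 2"
          by (simp add: power2_eq_square field_simps)
        moreover have "k * e\<^sup>2 / 2 \<ge> 0" using k by simp
        ultimately show ?thesis by simp
      qed
      also have "\<dots> = exp (- k * r\<^sup>2 / 2 - w r) * exp (k * e * r)" by (rule exp_add)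
      also have "\<dots> \<le> exp (- k * r\<^sup>2 / 2 - w r) * (1 + k * e * r + (k * e * r)\<^sup>2 * exp (k * D * r))"
      proof (rule mult_left_mono)
        have "\<bar>k * e * r\<bar> = k * \<bar>e\<bar> * r" using k that by (simp add: abs_mult)
        also have "\<dots> \<le> k * D * r" using k that e by (intro mult_right_mono mult_left_mono) auto
        finally have "(k * e * r)\<^sup>2 * exp \<bar>k * e * r\<bar> \<le> (k * e * r)\<^sup>2 * exp (k * D * r)"
          by (intro mult_left_mono) auto
        then show "exp (k * e * r) \<le> 1 + k * e * r + (k * e * r)\<^sup>2 * exp (k * D * r)"
          using exp_le_quadratic_remainder[of "k * e * r"] by linarith
      qed simp
      finally show ?thesis .
    qed
    have q: "exp (- k * r\<^sup>2 / 2 - w r) * (1 + k * e * r + (k * e * r)\<^sup>2 * exp (k * D * r)) = ?b r - s * J r" if "r > 0"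
      using that by (simp add: kern_def power_mult_distrib algebra_simps)
    show "kern e (- e + 1 * r) \<le> ?b r"
    proof (cases "r > 0")
      case pos: True
      show ?thesis
      proof (cases "r > e")
        case True
        then show ?thesis using main q pos by (simp add: J_def kern_def)
      next
        case False
        have "s \<le> exp (- k * r\<^sup>2 / 2 - w r)"
        proof -
          have "r\<^sup>2 \<le> e\<^sup>2" using False pos by (intro power_mono) auto
          then have "k * r\<^sup>2 \<le> k * e\<^sup>2" using k by simp
          moreover have "w r \<le> w e" using w_mono False by (auto simp: mono_def)
          ultimately show ?thesis using pos False by (simp add: s_def max_def)
        qed
        \<comment> \<open>Here \<open>e\<close> and \<open>r\<close> are both positive, so the
          bracket is at least 1.\<close>
        also have "\<dots> \<le> exp (- k * r\<^sup>2 / 2 - w r) * (1 + k * e * r + (k * e * r)\<^sup>2 * exp (k * D * r))"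
          using k pos False by (subst mult_le_cancel_left1) auto
        finally have "0 \<le> ?b r" using q pos False by (simp add: J_def)
        moreover have "kern e (- e + 1 * r) = 0" using False by (simp add: kern_def)
        ultimately show ?thesis by simp
      qed
    next
      case False
      have k0: "kern 0 r = 0" using False by (simp add: kern_def)
      show ?thesis
      proof (cases "r > e")
        case True
        then have "e < 0" using False by simp
        then have s: "s = exp (- w 0)" using w_neg[of e] by (simp add: s_def max_def)
        have "J r = 1" using True False \<open>e < 0\<close> by (simp add: J_def)
        then show ?thesis using kern_le_const[of e "- e + 1 * r"] k0 s by simp
      next
        case False': False
        have "J r = 0" using False False' by (auto simp: J_def)
        then show ?thesis using False' k0 by (simp add: kern_def)
      qed
    qed
  qed
  also have "\<dots> = Kint 0 + k * e * Rint + e\<^sup>2 * (\<integral>r. k\<^sup>2 * (r\<^sup>2 * exp (k * D * r) * kern 0 r) \<partial>lborel) + s * (- e)"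
    using Jint unfolding Kint_def Rint_def
    by (simp add: integrable_kern integrable_ident_kern integrable_square_kern has_bochner_integral_iff)
  finally show ?thesis unfolding s_def by (simp add: algebra_simps)
qed

text \<open>Log-concavity bounds the increment of \<open>ln Kint\<close> from 0 to \<open>d\<close>
  by \<open>1 / l\<close> times its increment from 0 to \<open>l * d\<close>. With
  \<open>ln x \<le> x - 1\<close> and the expansion in \<open>Kint_le\<close>, the tangent bound
  appears as \<open>l\<close> tends to 0 from the right.\<close>

lemma ln_Kint_le:
  "ln (Kint d) \<le> ln (Kint 0) + d * (k * Rint - exp (- w 0)) / Kint 0"
proof -
  \<comment> \<open>One remainder constant serves all \<open>l\<close> below 1, since
    \<open>\<bar>l * d\<bar> \<le> \<bar>d\<bar>\<close>.\<close>
  define Q where "Q = (\<integral>r. k\<^sup>2 * (r\<^sup>2 * exp (k * \<bar>d\<bar> * r) * kern 0 r) \<partial>lborel)"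
  define s where "s l = exp (- k * (max (l * d) 0)\<^sup>2 / 2 - w (l * d))" for l
  have bound: "ln (Kint d) - ln (Kint 0) \<le> (d * (k * Rint - s l) + l * (d\<^sup>2 * Q)) / Kint 0"
    if l: "0 < l" "l < 1" for l
  proof -
    have "(1 - l) * ln (Kint 0) + l * ln (Kint d) = ln (Kint 0 powr (1 - l) * Kint d powr l)"
      using Kint_pos[of 0] Kint_pos[of d] by (simp add: ln_mult ln_powr)
    also have "\<dots> \<le> ln (Kint (l * d))"
      by (intro ln_mono Kint_log_concave l) (use Kint_pos[of 0] Kint_pos[of d] Kint_pos[of "l*d"] in auto)
    finally have "l * (ln (Kint d) - ln (Kint 0)) \<le> ln (Kint (l * d) / Kint 0)"
      using Kint_pos[of 0] Kint_pos[of "l * d"] by (simp add: ln_div algebra_simps)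
    also have "\<dots> \<le> Kint (l * d) / Kint 0 - 1"
      by (rule ln_le_minus_one) (use Kint_pos[of 0] Kint_pos[of "l * d"] in auto)
    also have "\<dots> = (Kint (l * d) - Kint 0) / Kint 0" using Kint_pos[of 0] by (simp add: field_simps)
    also have "\<dots> \<le> (l * d * (k * Rint - s l) + (l * d)\<^sup>2 * Q) / Kint 0"
    proof (rule divide_right_mono)
      have "\<bar>l * d\<bar> \<le> \<bar>d\<bar>" using l by (simp add: abs_mult mult_left_le_one_le)
      from Kint_le[OF this] show "Kint (l * d) - Kint 0 \<le> l * d * (k * Rint - s l) + (l * d)\<^sup>2 * Q"
        by (simp add: s_def Q_def algebra_simps)
    qed (use Kint_pos[of 0] in simp)
    also have "\<dots> = l * ((d * (k * Rint - s l) + l * (d\<^sup>2 * Q)) / Kint 0)"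
      by (simp add: power2_eq_square algebra_simps)
    finally show ?thesis by (rule mult_left_le_imp_le) (use l in simp)
  qed
  \<comment> \<open>A real convex function on the line is continuous, so \<open>s l\<close> tends to
    \<open>exp (- w 0)\<close>.\<close>
  have "continuous_on UNIV w" by (rule convex_on_continuous[OF _ w_convex]) simp
  then have wc: "isCont w 0" by (simp add: continuous_on_eq_continuous_at)
  have "((\<lambda>l. (d * (k * Rint - s l) + l * (d\<^sup>2 * Q)) / Kint 0) \<longlongrightarrow>
      (d * (k * Rint - exp (- k * (max (0 * d) 0)\<^sup>2 / 2 - w 0)) + 0 * (d\<^sup>2 * Q)) / Kint 0) (at_right 0)"
    unfolding s_def
    by (intro tendsto_intros isCont_tendsto_compose[OF wc]) (use Kint_pos[of 0] in \<open>auto intro!: tendsto_eq_intros\<close>)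
  then have lim: "((\<lambda>l. (d * (k * Rint - s l) + l * (d\<^sup>2 * Q)) / Kint 0) \<longlongrightarrow>
      d * (k * Rint - exp (- w 0)) / Kint 0) (at_right 0)" by simp
  have "eventually (\<lambda>l::real. 0 < l \<and> l < 1) (at_right 0)"
    using eventually_at_right_real[of 0 1] by simp
  then have "eventually (\<lambda>l. ln (Kint d) - ln (Kint 0) \<le> (d * (k * Rint - s l) + l * (d\<^sup>2 * Q)) / Kint 0) (at_right 0)"
    by (rule eventually_mono) (use bound in auto)
  from tendsto_lowerbound[OF lim this] show ?thesis by simp
qed

end

subsection \<open>Half-line and two-sided bounds\<close>

text \<open>Jensen's inequality for \<open>exp\<close> under the normalised weight \<open>u\<close>,
  proved by integrating the tangent of \<open>exp\<close> at \<open>c'\<close>, that is, at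
  \<open>c\<close> times the mean. An infinite right-hand side is trivial.\<close>

lemma tilted_integral_ge:
  fixes u :: "real \<Rightarrow> real" and c :: real
  assumes [measurable]: "u \<in> borel_measurable borel" and u0: "\<And>x. 0 \<le> u x"
    and iu: "integrable lborel u" and ixu: "integrable lborel (\<lambda>x. x * u x)"
    and M: "0 < (\<integral>x. u x \<partial>lborel)"
  shows "ennreal ((\<integral>x. u x \<partial>lborel) * exp (c * (\<integral>x. x * u x \<partial>lborel) / (\<integral>x. u x \<partial>lborel)))
    \<le> (\<integral>\<^sup>+x. ennreal (u x * exp (c * x)) \<partial>lborel)"
proof (cases "(\<integral>\<^sup>+x. ennreal (u x * exp (c * x)) \<partial>lborel) = \<infinity>")
  case False
  define c' where "c' = c * (\<integral>x. x * u x \<partial>lborel) / (\<integral>x. u x \<partial>lborel)"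
  have ie: "integrable lborel (\<lambda>x. u x * exp (c * x))"
    using False u0 by (intro integrableI_nonneg) (auto simp: top.not_eq_extremum)
  \<comment> \<open>By the choice of \<open>c'\<close> the linear term of the tangent integrates to
    zero.\<close>
  have "(\<integral>x. u x \<partial>lborel) * exp c' = (\<integral>x. exp c' * ((1 - c') * u x + c * (x * u x)) \<partial>lborel)"
  proof -
    have "(1 - c') * (\<integral>x. u x \<partial>lborel) + c * (\<integral>x. x * u x \<partial>lborel) = (\<integral>x. u x \<partial>lborel)"
      using M by (simp add: c'_def left_diff_distrib)
    then show ?thesis using iu ixu by simp
  qed
  also have "\<dots> \<le> (\<integral>x. u x * exp (c * x) \<partial>lborel)"
  proof (rule integral_mono)
    show "integrable lborel (\<lambda>x. exp c' * ((1 - c') * u x + c * (x * u x)))"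
      using iu ixu by (intro integrable_mult_right Bochner_Integration.integrable_add)
    fix x :: real
    have "exp c' * (1 + (c * x - c')) \<le> exp c' * exp (c * x - c')"
      by (intro mult_left_mono exp_ge_add_one_self) auto
    then have "exp c' * (1 + (c * x - c')) \<le> exp (c * x)" by (simp add: mult_exp_exp)
    then have "u x * (exp c' * (1 + (c * x - c'))) \<le> u x * exp (c * x)" using u0 by (intro mult_left_mono)
    then show "exp c' * ((1 - c') * u x + c * (x * u x)) \<le> u x * exp (c * x)" by (simp add: algebra_simps)
  qed (rule ie)
  finally show ?thesis
    using ie u0 unfolding c'_def by (subst nn_integral_eq_integral) auto
qed simp

text \<open>A convex function with its minimum at 0 is nondecreasing on the nonnegative axis, and a
  nondecreasing convex function composed with the convex map \<open>max u 0\<close> remains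
  convex.\<close>

lemma half_line_potentialI:
  assumes k: "k > 0" and W: "convex_on UNIV W" and W0: "\<And>x. W 0 \<le> W x"
  shows "half_line_potential k (\<lambda>u. W (max u 0))"
proof
  have mono: "W x \<le> W y" if "0 \<le> x" "x \<le> y" for x y
  proof (cases "y = 0")
    case False
    define t where "t = x / y"
    have t: "0 \<le> t" "t \<le> 1" and x: "x = (1 - t) * 0 + t * y" using that False by (auto simp: t_def)
    have "W x \<le> (1 - t) * W 0 + t * W y" unfolding x using convex_onD[OF W t, of 0 y] by simp
    also have "\<dots> \<le> (1 - t) * W y + t * W y" using t by (intro add_right_mono mult_left_mono W0) auto
    finally show ?thesis by (simp add: algebra_simps)
  qed (use that in auto)
  show "mono (\<lambda>u. W (max u 0))" by (auto simp: mono_def intro!: mono)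
  show "convex_on UNIV (\<lambda>u. W (max u 0))"
  proof (intro convex_onI)
    fix t x y :: real assume t: "0 < t" "t < 1"
    have "(1 - t) * x \<le> (1 - t) * max x 0" "t * y \<le> t * max y 0" "0 \<le> (1 - t) * max x 0" "0 \<le> t * max y 0"
      using t by (auto intro: mult_left_mono)
    then have "W (max ((1 - t) * x + t * y) 0) \<le> W ((1 - t) * max x 0 + t * max y 0)"
      by (intro mono) auto
    also have "\<dots> \<le> (1 - t) * W (max x 0) + t * W (max y 0)"
      using convex_onD[OF W, of t] t by simp
    finally show "W (max ((1 - t) *\<^sub>R x + t *\<^sub>R y) 0) \<le> (1 - t) * W (max x 0) + t * W (max y 0)" by simp
  qed simp
qed (use k in auto)

lemma half_line_bound:
  fixes W \<phi> \<psi> :: "real \<Rightarrow> real" and k a b :: real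
  assumes k: "k > 0" and W: "convex_on UNIV W" and W0: "\<And>x. W 0 \<le> W x"
    and [measurable]: "\<phi> \<in> borel_measurable borel" "\<psi> \<in> borel_measurable borel"
    and \<phi>0: "\<And>x. 0 \<le> \<phi> x" and \<psi>0: "\<And>x. 0 \<le> \<psi> x"
    and i\<phi>: "integrable lborel \<phi>" "integrable lborel (\<lambda>x. x * \<phi> x)"
    and i\<psi>: "integrable lborel \<psi>" "integrable lborel (\<lambda>x. x * \<psi> x)"
    and le: "\<And>x y. \<phi> x * \<psi> y \<le> exp (- k * x * y - W x - W y)"
  defines "M\<phi> \<equiv> (\<integral>x. \<phi> x * indicator {a<..} x \<partial>lborel)"
    and "M\<psi> \<equiv> (\<integral>x. \<psi> x * indicator {b<..} x \<partial>lborel)"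
    and "X\<phi> \<equiv> (\<integral>x. x * (\<phi> x * indicator {a<..} x) \<partial>lborel)"
    and "X\<psi> \<equiv> (\<integral>x. x * (\<psi> x * indicator {b<..} x) \<partial>lborel)"
    and "K \<equiv> (\<integral>x. exp (- k * x\<^sup>2 / 2 - W x) * indicator {0<..} x \<partial>lborel)"
    and "R \<equiv> (\<integral>x. x * (exp (- k * x\<^sup>2 / 2 - W x) * indicator {0<..} x) \<partial>lborel)"
  assumes M: "0 < M\<phi>" "0 < M\<psi>"
  shows "ln M\<phi> + ln M\<psi> + k * (b * X\<phi> / M\<phi> + a * X\<psi> / M\<psi>)
    \<le> k * a * b + 2 * ln K + (a + b) * (k * R - exp (- W 0)) / K"
proof -
  \<comment> \<open>Cutting \<open>W\<close> off below 0 leaves it unchanged on the half-line, so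
    \<open>K\<close> and \<open>R\<close> keep their values; as \<open>w\<close> lies below
    \<open>W\<close>, upper bounds with \<open>exp (- W x)\<close> pass to \<open>w\<close>.\<close>
  define w where "w u = W (max u 0)" for u
  interpret half_line_potential k w
    unfolding w_def by (rule half_line_potentialI[OF k W W0])
  have kern0: "kern 0 = (\<lambda>r. exp (- k * r\<^sup>2 / 2 - W r) * indicator {0<..} r)"
    by (rule ext) (auto simp: kern_def w_def indicator_def)
  have K: "Kint 0 = K" and R: "Rint = R" unfolding Kint_def Rint_def kern0 K_def R_def by auto
  have W_ge: "w u \<le> W u" for u using W0[of u] by (auto simp: w_def max_def)
  define d where "d = (a + b) / 2"
  define H where "H r = exp (k * a * b / 2) * kern d r" for r
  \<comment> \<open>Both half-lines are translated to start at 0. The slopes \<open>k * b\<close>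
    and \<open>k * a\<close> of the tilts are crossed, so that the linear terms of the cost
    cancel.\<close>
  define f where "f s = \<phi> (a + 1 * s) * exp (k * b * (a + 1 * s))" for s
  define g where "g t = \<psi> (b + 1 * t) * exp (k * a * (b + 1 * t))" for t
  have [measurable]: "f \<in> borel_measurable borel" "g \<in> borel_measurable borel" "H \<in> borel_measurable borel"
    unfolding f_def g_def H_def by measurable
  \<comment> \<open>Jensen lower bounds for the integrals of \<open>f\<close> and \<open>g\<close>
    over the positive half-line.\<close>
  define A where "A = M\<phi> * exp (k * b * X\<phi> / M\<phi>)"
  define B where "B = M\<psi> * exp (k * a * X\<psi> / M\<psi>)"
  have A: "A > 0" and B: "B > 0" using M by (auto simp: A_def B_def)
  have tilt: "ennreal (integral\<^sup>L lborel (\<lambda>x. u x * indicator {a<..} x) * exp (c * integral\<^sup>L lborel (\<lambda>x. x * (u x * indicator {a<..} x)) /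
        integral\<^sup>L lborel (\<lambda>x. u x * indicator {a<..} x)))
      \<le> (\<integral>\<^sup>+s. ennreal (u (a + 1 * s) * exp (c * (a + 1 * s)) * indicator {0<..} s) \<partial>lborel)"
    if [measurable]: "u \<in> borel_measurable borel" and u: "\<And>x. 0 \<le> u x" "integrable lborel u" "integrable lborel (\<lambda>x. x * u x)"
      and pos: "0 < integral\<^sup>L lborel (\<lambda>x. u x * indicator {a<..} x)"
    for u :: "real \<Rightarrow> real" and a c :: real
  proof -
    have "integrable lborel (\<lambda>x. (x * u x) * indicator {a<..} x)"
      by (rule integrable_real_mult_indicator) (use u in auto)
    have "ennreal (integral\<^sup>L lborel (\<lambda>x. u x * indicator {a<..} x) * exp (c * integral\<^sup>L lborel (\<lambda>x. x * (u x * indicator {a<..} x)) /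
        integral\<^sup>L lborel (\<lambda>x. u x * indicator {a<..} x)))
      \<le> (\<integral>\<^sup>+x. ennreal (u x * indicator {a<..} x * exp (c * x)) \<partial>lborel)"
      using u pos by (intro tilted_integral_ge) (auto simp: integrable_real_mult_indicator mult.assoc[symmetric])
    also have "\<dots> = ennreal \<bar>1\<bar> * (\<integral>\<^sup>+s. ennreal (u (a + 1 * s) * indicator {a<..} (a + 1 * s) * exp (c * (a + 1 * s))) \<partial>lborel)"
      by (rule nn_integral_real_affine) auto
    also have "\<dots> = (\<integral>\<^sup>+s. ennreal (u (a + 1 * s) * exp (c * (a + 1 * s)) * indicator {0<..} s) \<partial>lborel)"
      by (auto intro!: nn_integral_cong simp: indicator_def)
    finally show ?thesis .
  qed
  have "ennreal (sqrt (A * B)) \<le> (\<integral>\<^sup>+r. ennreal (H r * indicator {0<..} r) \<partial>lborel)"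
  proof (rule prekopa_leindler_geometric[where f=f and g=g])
    show "0 \<le> f x" "0 \<le> g x" "0 \<le> H x" for x by (simp_all add: f_def g_def H_def \<phi>0 \<psi>0 kern_nonneg)
    show "0 \<le> A" "0 \<le> B" using A B by auto
    show "ennreal A \<le> (\<integral>\<^sup>+x. ennreal (f x * indicator {0<..} x) \<partial>lborel)"
      unfolding A_def f_def M\<phi>_def X\<phi>_def by (rule tilt) (use M \<phi>0 i\<phi> in \<open>auto simp: M\<phi>_def\<close>)
    show "ennreal B \<le> (\<integral>\<^sup>+x. ennreal (g x * indicator {0<..} x) \<partial>lborel)"
      unfolding B_def g_def M\<psi>_def X\<psi>_def by (rule tilt) (use M \<psi>0 i\<psi> in \<open>auto simp: M\<psi>_def\<close>)
    show "r * H r \<le> exp (k * a * b / 2) * (exp (- w 0) * (1 + 2 / k))" if "0 < r" for r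
    proof -
      \<comment> \<open>Bounding \<open>r\<close> by \<open>1 + r\<^sup>2\<close> and
        \<open>r\<^sup>2\<close> by \<open>2 / k * exp (k * r\<^sup>2 / 2)\<close> yields the
        constant \<open>1 + 2 / k\<close>.\<close>
      have "1 + k * r\<^sup>2 / 2 \<le> exp (k * r\<^sup>2 / 2)" by (rule exp_ge_add_one_self)
      then have "2 / k * (1 + k * r\<^sup>2 / 2) \<le> 2 / k * exp (k * r\<^sup>2 / 2)" using k by (intro mult_left_mono) auto
      moreover have "2 / k * (1 + k * r\<^sup>2 / 2) = 2 / k + r\<^sup>2" using k by (simp add: field_simps)
      moreover have "2 / k > 0" using k by simp
      ultimately have "r\<^sup>2 \<le> 2 / k * exp (k * r\<^sup>2 / 2)" by linarith
      moreover have "1 \<le> exp (k * r\<^sup>2 / 2)" using k by simp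
      moreover have "r \<le> 1 + r\<^sup>2" using zero_le_power2[of "r - 1/2"] by (simp add: power2_diff field_simps)
      ultimately have "r \<le> (1 + 2 / k) * exp (k * r\<^sup>2 / 2)" unfolding distrib_right by linarith
      then have "r * kern d r \<le> ((1 + 2 / k) * exp (k * r\<^sup>2 / 2)) * (exp (- w 0) * exp (0 * r - k * r\<^sup>2 / 2))"
        by (intro mult_mono kern_le) (use k that kern_nonneg in auto)
      also have "\<dots> = exp (- w 0) * (1 + 2 / k)" by (simp add: mult_exp_exp mult_ac)
      finally show ?thesis unfolding H_def by (simp add: mult_ac)
    qed
    fix s t :: real assume st: "0 < s" "0 < t"
    define r where "r = sqrt (s * t)"
    have r: "0 < r" "r\<^sup>2 = s * t" using st by (auto simp: r_def)
    have "f s * g t = (\<phi> (a + s) * \<psi> (b + t)) * exp (k * b * (a + s) + k * a * (b + t))"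
      by (simp add: f_def g_def exp_add mult_ac)
    also have "\<dots> \<le> exp (- k * (a + s) * (b + t) - W (a + s) - W (b + t)) * exp (k * b * (a + s) + k * a * (b + t))"
      by (intro mult_right_mono le) auto
    \<comment> \<open>The terms linear in \<open>s\<close> and in \<open>t\<close> cancel; of the
      product only \<open>k * (s * t)\<close> and the constant \<open>k * a * b\<close>
      survive.\<close>
    also have "\<dots> = exp (k * a * b - k * (s * t) - W (a + s) - W (b + t))"
      by (simp add: mult_exp_exp algebra_simps)
    also have "\<dots> \<le> exp (k * a * b - k * (s * t) - 2 * w (d + r))"
    proof -
      \<comment> \<open>The geometric mean lies below the arithmetic mean, and \<open>w\<close> is
        nondecreasing; midpoint convexity then separates the two arguments.\<close>
      have "r \<le> (s + t) / 2" unfolding r_def using st arith_geo_mean_sqrt[of s t] by simp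
      then have "w (d + r) \<le> w ((1 - 1/2) * (a + s) + 1/2 * (b + t))"
        using w_mono by (auto simp: mono_def d_def field_simps)
      also have "\<dots> \<le> (1 - 1/2) * w (a + s) + 1/2 * w (b + t)"
        using convex_onD[OF w_convex, of "1/2" "a + s" "b + t"] by simp
      finally have "2 * w (d + r) \<le> w (a + s) + w (b + t)" by simp
      then show ?thesis using W_ge[of "a + s"] W_ge[of "b + t"] by simp
    qed
    also have "\<dots> = (H r)\<^sup>2"
      using r by (simp add: H_def kern_def power_mult_distrib power2_eq_square[of "exp _"] mult_exp_exp)
    finally show "f s * g t \<le> (H (sqrt (s * t)))\<^sup>2" by (simp add: r_def)
  qed simp_all
  also have "(\<integral>\<^sup>+r. ennreal (H r * indicator {0<..} r) \<partial>lborel) = (\<integral>\<^sup>+r. ennreal (exp (k * a * b / 2)) * ennreal (kern d r) \<partial>lborel)"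
    by (rule nn_integral_cong) (auto simp: H_def kern_def ennreal_mult'' indicator_def)
  also have "\<dots> = ennreal (exp (k * a * b / 2)) * ennreal (Kint d)"
    unfolding Kint_def by (subst nn_integral_cmult) (auto simp: nn_integral_eq_integral integrable_kern kern_nonneg)
  also have "\<dots> = ennreal (exp (k * a * b / 2) * Kint d)" by (simp add: ennreal_mult')
  finally have "sqrt (A * B) \<le> exp (k * a * b / 2) * Kint d"
    using Kint_pos[of d] by simp
  then have "(sqrt (A * B))\<^sup>2 \<le> (exp (k * a * b / 2) * Kint d)\<^sup>2"
    using A B by (intro power_mono) auto
  then have "A * B \<le> exp (k * a * b) * (Kint d)\<^sup>2"
    using A B by (simp add: power_mult_distrib exp_double[symmetric])
  then have "ln (A * B) \<le> ln (exp (k * a * b) * (Kint d)\<^sup>2)"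
    using A B Kint_pos[of d] by (intro ln_mono) auto
  then have "ln A + ln B \<le> k * a * b + 2 * ln (Kint d)"
    using A B Kint_pos[of d] by (simp add: ln_mult ln_realpow)
  also have "\<dots> \<le> k * a * b + 2 * (ln K + d * (k * R - exp (- W 0)) / K)"
    using ln_Kint_le[of d] unfolding K R by (simp add: w_def)
  also have "\<dots> = k * a * b + 2 * ln K + (a + b) * (k * R - exp (- W 0)) / K"
    by (simp add: d_def)
  finally have "ln A + ln B \<le> k * a * b + 2 * ln K + (a + b) * (k * R - exp (- W 0)) / K" .
  moreover have "ln A + ln B = ln M\<phi> + ln M\<psi> + k * (b * X\<phi> / M\<phi> + a * X\<psi> / M\<psi>)"
    using M by (simp add: A_def B_def ln_mult algebra_simps)
  ultimately show ?thesis by simp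
qed

section \<open>Combining the two half-lines\<close>

lemma integral_reflect: "(\<integral>x. f (- x) \<partial>lborel) = (\<integral>x. f x \<partial>lborel)" for f :: "real \<Rightarrow> real"
  using lborel_integral_real_affine[of "-1" f 0] by simp

lemma integrable_reflect: "integrable lborel f \<Longrightarrow> integrable lborel (\<lambda>x. f (- x))" for f :: "real \<Rightarrow> real"
  using lborel_integrable_real_affine[of f "-1" 0] by simp

lemma integral_split_at:
  fixes f :: "real \<Rightarrow> real"
  assumes f: "integrable lborel f"
  shows "(\<integral>x. f x \<partial>lborel) = (\<integral>x. f x * indicator {..<a} x \<partial>lborel) + (\<integral>x. f x * indicator {a<..} x \<partial>lborel)"
proof -
  have "AE x in lborel. x \<noteq> a" by (rule AE_lborel_singleton)
  then have "(\<integral>x. f x \<partial>lborel) = (\<integral>x. f x * indicator {..<a} x + f x * indicator {a<..} x \<partial>lborel)"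
    using f by (intro integral_cong_AE) (auto simp: indicator_def elim!: eventually_mono)
  also have "\<dots> = (\<integral>x. f x * indicator {..<a} x \<partial>lborel) + (\<integral>x. f x * indicator {a<..} x \<partial>lborel)"
    using f by (intro Bochner_Integration.integral_add integrable_real_mult_indicator) auto
  finally show ?thesis .
qed

text \<open>Equal quantile levels give \<open>q\<close>, \<open>\<phi>\<close> and
  \<open>\<psi>\<close> the same proportion of mass on matching half-lines, so in each half-line
  bound the logarithm of that proportion cancels. The lower half-lines are treated by
  reflection.\<close>

theorem two_sided_bound:
  fixes W \<phi> \<psi> :: "real \<Rightarrow> real" and k a b p :: real
  assumes k: "k > 0" and W: "convex_on UNIV W" and W0: "\<And>x. W 0 \<le> W x"
    and [measurable]: "\<phi> \<in> borel_measurable borel" "\<psi> \<in> borel_measurable borel"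
    and \<phi>0: "\<And>x. 0 \<le> \<phi> x" and \<psi>0: "\<And>x. 0 \<le> \<psi> x"
    and i\<phi>: "integrable lborel \<phi>" "integrable lborel (\<lambda>x. x * \<phi> x)"
    and i\<psi>: "integrable lborel \<psi>" "integrable lborel (\<lambda>x. x * \<psi> x)"
    and le: "\<And>x y. \<phi> x * \<psi> y \<le> exp (- k * x * y - W x - W y)"
  defines "Z\<phi> \<equiv> (\<integral>x. \<phi> x \<partial>lborel)" and "Z\<psi> \<equiv> (\<integral>x. \<psi> x \<partial>lborel)"
    and "q \<equiv> (\<lambda>x. exp (- k * x\<^sup>2 / 2 - W x))"
  assumes Z: "0 < Z\<phi>" "0 < Z\<psi>" and p: "0 < p" "p < 1"
    and q: "integrable lborel q" "integrable lborel (\<lambda>x. x * q x)" "(\<integral>x. q x \<partial>lborel) = 1"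
    and quantile: "(\<integral>x. q x * indicator {..<0} x \<partial>lborel) = p"
      "(\<integral>x. \<phi> x * indicator {..<a} x \<partial>lborel) = p * Z\<phi>"
      "(\<integral>x. \<psi> x * indicator {..<b} x \<partial>lborel) = p * Z\<psi>"
  shows "ln Z\<phi> + ln Z\<psi> + k * (b * (\<integral>x. x * \<phi> x \<partial>lborel) / Z\<phi> + a * (\<integral>x. x * \<psi> x \<partial>lborel) / Z\<psi>)
    \<le> k * (a * b + (a + b) * (\<integral>x. x * q x \<partial>lborel))"
proof -
  define Xp where "Xp f c = (\<integral>x. x * (f x * indicator {c<..} x) \<partial>lborel)" for f :: "real \<Rightarrow> real" and c
  define Xm where "Xm f c = (\<integral>x. x * f x * indicator {..<c} x \<partial>lborel)" for f :: "real \<Rightarrow> real" and c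
  have X: "(\<integral>x. x * f x \<partial>lborel) = Xm f c + Xp f c" if "integrable lborel (\<lambda>x. x * f x)" for f c
    unfolding Xp_def Xm_def mult.assoc[symmetric] by (rule integral_split_at[OF that])
  have upper: "(\<integral>x. q x * indicator {0<..} x \<partial>lborel) = 1 - p"
      "(\<integral>x. \<phi> x * indicator {a<..} x \<partial>lborel) = (1 - p) * Z\<phi>"
      "(\<integral>x. \<psi> x * indicator {b<..} x \<partial>lborel) = (1 - p) * Z\<psi>"
    using integral_split_at[OF q(1), of 0] integral_split_at[OF i\<phi>(1), of a] integral_split_at[OF i\<psi>(1), of b] q(3)
    unfolding quantile by (simp_all add: Z\<phi>_def Z\<psi>_def algebra_simps)
  have scale: "t * (u + v / t) = t * u + v"
      "t * (u + k * (b * x / (t * Z\<phi>) + a * y / (t * Z\<psi>))) = t * u + k * (b * x / Z\<phi> + a * y / Z\<psi>)"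
    if "t \<noteq> 0" for t u v x y :: real
    using that Z by (simp_all add: field_simps)
  have p': "1 - p \<noteq> 0" using p by simp
  define U where "U = ln Z\<phi> + ln Z\<psi>"
  have "ln ((1 - p) * Z\<phi>) + ln ((1 - p) * Z\<psi>) + k * (b * Xp \<phi> a / ((1 - p) * Z\<phi>) + a * Xp \<psi> b / ((1 - p) * Z\<psi>))
      \<le> k * a * b + 2 * ln (1 - p) + (a + b) * (k * Xp q 0 - exp (- W 0)) / (1 - p)"
    using half_line_bound[OF k W W0 _ _ \<phi>0 \<psi>0 i\<phi> i\<psi> le, of a b] Z p
    unfolding Xp_def upper[unfolded q_def] q_def by (simp add: upper)
  \<comment> \<open>The term \<open>2 * ln (1 - p)\<close> cancels against the logarithms of the two
    half masses.\<close>
  then have "U + k * (b * Xp \<phi> a / ((1 - p) * Z\<phi>) + a * Xp \<psi> b / ((1 - p) * Z\<psi>))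
      \<le> k * a * b + (a + b) * (k * Xp q 0 - exp (- W 0)) / (1 - p)"
    using Z p by (simp add: ln_mult U_def)
  then have "(1 - p) * (U + k * (b * Xp \<phi> a / ((1 - p) * Z\<phi>) + a * Xp \<psi> b / ((1 - p) * Z\<psi>)))
      \<le> (1 - p) * (k * a * b + (a + b) * (k * Xp q 0 - exp (- W 0)) / (1 - p))"
    using p by (intro mult_left_mono) auto
  then have pos: "(1 - p) * U + k * (b * Xp \<phi> a / Z\<phi> + a * Xp \<psi> b / Z\<psi>)
      \<le> (1 - p) * (k * a * b) + (a + b) * (k * Xp q 0 - exp (- W 0))"
    unfolding scale(1)[of "1 - p", OF p'] scale(2)[of "1 - p", OF p'] .
  \<comment> \<open>Reflection replaces \<open>a\<close> and \<open>b\<close> by their negatives and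
    reverses the first moments; the products \<open>a * b\<close> and \<open>x * y\<close> are
    unchanged, so the hypothesis on \<open>\<phi>\<close> and \<open>\<psi>\<close>
    persists.\<close>
  define W' where "W' x = W (- x)" for x
  define \<phi>' where "\<phi>' x = \<phi> (- x)" for x
  define \<psi>' where "\<psi>' x = \<psi> (- x)" for x
  have [measurable]: "\<phi>' \<in> borel_measurable borel" "\<psi>' \<in> borel_measurable borel"
    unfolding \<phi>'_def \<psi>'_def by measurable
  have W'c: "convex_on UNIV W'"
  proof (intro convex_onI)
    fix t x y :: real assume "0 < t" "t < 1"
    then show "W' ((1 - t) *\<^sub>R x + t *\<^sub>R y) \<le> (1 - t) * W' x + t * W' y"
      using convex_onD[OF W, of t "-x" "-y"] by (simp add: W'_def algebra_simps)
  qed simp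
  have W'0: "W' 0 \<le> W' x" for x using W0[of "- x"] by (simp add: W'_def)
  have i\<phi>': "integrable lborel \<phi>'" "integrable lborel (\<lambda>x. x * \<phi>' x)"
    and i\<psi>': "integrable lborel \<psi>'" "integrable lborel (\<lambda>x. x * \<psi>' x)"
    using integrable_reflect[OF i\<phi>(1)] integrable_reflect[OF i\<phi>(2)]
      integrable_reflect[OF i\<psi>(1)] integrable_reflect[OF i\<psi>(2)]
    by (simp_all add: \<phi>'_def[abs_def] \<psi>'_def[abs_def])
  have le': "\<phi>' x * \<psi>' y \<le> exp (- k * x * y - W' x - W' y)" for x y
    using le[of "-x" "-y"] by (simp add: \<phi>'_def \<psi>'_def W'_def)
  have ind: "indicator {- c<..} (- x) = (indicator {..<c} x :: real)" for c x :: real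
    by (simp add: indicator_def)
  have M: "(\<integral>x. f (- x) * indicator {- c<..} x \<partial>lborel) = (\<integral>x. f x * indicator {..<c} x \<partial>lborel)" for f :: "real \<Rightarrow> real" and c
    using integral_reflect[of "\<lambda>x. f (- x) * indicator {- c<..} x"] by (simp add: ind)
  have X': "(\<integral>x. x * (f (- x) * indicator {- c<..} x) \<partial>lborel) = - Xm f c" for f :: "real \<Rightarrow> real" and c
    using integral_reflect[of "\<lambda>x. x * (f (- x) * indicator {- c<..} x)"] by (simp add: ind Xm_def mult.assoc)
  have qm: "exp (- k * x\<^sup>2 / 2 - W' x) = q (- x)" for x by (simp add: q_def W'_def)
  have M0: "(\<integral>x. q (- x) * indicator {0<..} x \<partial>lborel) = p"
    using M[of q 0] quantile(1) by simp
  have X0: "(\<integral>x. x * (q (- x) * indicator {0<..} x) \<partial>lborel) = - Xm q 0"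
    using X'[of q 0] by simp
  have "ln (p * Z\<phi>) + ln (p * Z\<psi>) + k * (- b * - Xm \<phi> a / (p * Z\<phi>) + - a * - Xm \<psi> b / (p * Z\<psi>))
      \<le> k * - a * - b + 2 * ln p + (- a + - b) * (k * - Xm q 0 - exp (- W' 0)) / p"
    using half_line_bound[OF k W'c W'0 _ _ _ _ i\<phi>' i\<psi>' le', of "-a" "-b"] Z p \<phi>0 \<psi>0
    unfolding qm unfolding \<phi>'_def \<psi>'_def M X' quantile by (simp add: M0 X0)
  then have "U + k * (b * Xm \<phi> a / (p * Z\<phi>) + a * Xm \<psi> b / (p * Z\<psi>))
      \<le> k * a * b + (a + b) * (k * Xm q 0 + exp (- W 0)) / p"
    using Z p by (simp add: ln_mult U_def W'_def algebra_simps add_divide_distrib diff_divide_distrib)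
  then have "p * (U + k * (b * Xm \<phi> a / (p * Z\<phi>) + a * Xm \<psi> b / (p * Z\<psi>)))
      \<le> p * (k * a * b + (a + b) * (k * Xm q 0 + exp (- W 0)) / p)"
    using p by (intro mult_left_mono) auto
  then have neg: "p * U + k * (b * Xm \<phi> a / Z\<phi> + a * Xm \<psi> b / Z\<psi>)
      \<le> p * (k * a * b) + (a + b) * (k * Xm q 0 + exp (- W 0))"
    unfolding scale(1)[of p, OF less_imp_neq[OF p(1), symmetric]] scale(2)[of p, OF less_imp_neq[OF p(1), symmetric]] .
  have "(1 - p) * U + k * (b * Xp \<phi> a / Z\<phi> + a * Xp \<psi> b / Z\<psi>) + (p * U + k * (b * Xm \<phi> a / Z\<phi> + a * Xm \<psi> b / Z\<psi>))
     = U + k * (b * (Xm \<phi> a + Xp \<phi> a) / Z\<phi> + a * (Xm \<psi> b + Xp \<psi> b) / Z\<psi>)"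
    by (simp add: algebra_simps add_divide_distrib)
  \<comment> \<open>The two boundary values \<open>exp (- W 0)\<close> have opposite signs and
    cancel, while the half-line moments of \<open>q\<close> add up.\<close>
  moreover have "(1 - p) * (k * a * b) + (a + b) * (k * Xp q 0 - exp (- W 0)) + (p * (k * a * b) + (a + b) * (k * Xm q 0 + exp (- W 0)))
     = k * (a * b + (a + b) * (Xm q 0 + Xp q 0))"
    by (simp add: algebra_simps)
  ultimately show ?thesis
    using add_mono[OF pos neg] unfolding X[OF i\<phi>(2), of a] X[OF i\<psi>(2), of b] X[OF q(2), of 0] U_def
    by simp
qed

subsection \<open>Quantiles and the functional Santalo inequality\<close>

text \<open>Values of the distribution function to the right of the infimum are at least
  \<open>p\<close> and those to the left at most \<open>p\<close>. Without atoms it is continuous,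
  so both one-sided limits equal its value at the infimum.\<close>

lemma cdf_cdf_inverse:
  assumes M: "real_distribution M" and atom: "\<And>x. measure M {x} = 0" and p: "0 < p" "p < 1"
  shows "cdf M (cdf_inverse M p) = p"
proof -
  interpret real_distribution M by fact
  have cont: "isCont (cdf M) x" for x using isCont_cdf[of x] atom[of x] by blast
  define S where "S = {y. p < cdf M y}"
  define a where "a = Inf S"
  have "eventually (\<lambda>y. p < cdf M y) at_top" by (rule order_tendstoD(1)[OF cdf_lim_at_top_prob p(2)])
  then obtain y where "y \<in> S" unfolding S_def by (metis eventually_at_top_linorder mem_Collect_eq order_refl)
  have "eventually (\<lambda>y. cdf M y < p) at_bot" by (rule order_tendstoD(2)[OF cdf_lim_at_bot p(1)])
  then obtain z where z: "cdf M z < p" unfolding eventually_at_bot_linorder by auto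
  have bdd: "bdd_below S"
  proof (rule bdd_belowI)
    fix y assume "y \<in> S"
    then show "z \<le> y" using z cdf_nondecreasing[of y z] by (force simp: S_def)
  qed
  have le: "p \<le> cdf M a"
  proof (rule tendsto_lowerbound)
    show "(cdf M \<longlongrightarrow> cdf M a) (at_right a)"
      using cdf_is_right_cont[of a] by (simp add: continuous_within)
    show "eventually (\<lambda>x. p \<le> cdf M x) (at_right a)"
    proof (rule eventually_mono[OF eventually_at_right_less])
      fix x assume "a < x"
      then obtain y where "y \<in> S" "y < x"
        unfolding a_def using \<open>y \<in> S\<close> bdd cInf_less_iff[of S x] by auto
      then show "p \<le> cdf M x" using cdf_nondecreasing[of y x] by (simp add: S_def)
    qed
  qed simp
  have ge: "cdf M a \<le> p"
  proof (rule tendsto_upperbound)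
    show "(cdf M \<longlongrightarrow> cdf M a) (at_left a)"
      using cont[of a] by (simp add: isCont_def filterlim_at_split)
    show "eventually (\<lambda>x. cdf M x \<le> p) (at_left a)"
    proof (rule eventually_mono[OF eventually_at_left_real[of "a - 1" a]])
      fix x assume "x \<in> {a - 1<..<a}"
      then have "x \<notin> S" using cInf_lower[OF _ bdd] unfolding a_def by force
      then show "cdf M x \<le> p" by (simp add: S_def)
    qed simp
  qed simp
  show ?thesis using le ge unfolding cdf_inverse_def a_def S_def by simp
qed

text \<open>Densities are kept unnormalised, with total mass \<open>Z\<close>. The reference
  measure, its tilts and the truncated tilts of the Santalo argument are all instances.\<close>

locale lebesgue_density =
  fixes f :: "real \<Rightarrow> real" and Z :: real and M :: "real measure"
  assumes borel[measurable]: "f \<in> borel_measurable borel" and nonneg: "\<And>x. 0 \<le> f x"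
    and integrable: "integrable lborel f" and pos: "0 < Z"
    and Z_def: "Z = (\<integral>x. f x \<partial>lborel)"
    and M_def: "M = density lborel (\<lambda>x. ennreal (f x / Z))"
begin

lemma emeasure_eq:
  assumes [measurable]: "A \<in> sets borel"
  shows "emeasure M A = ennreal ((\<integral>x. f x * indicator A x \<partial>lborel) / Z)"
proof -
  have "emeasure M A = (\<integral>\<^sup>+x. ennreal (f x * indicator A x / Z) \<partial>lborel)"
    unfolding M_def by (subst emeasure_density) (auto intro!: nn_integral_cong simp: indicator_def)
  also have "\<dots> = ennreal (\<integral>x. f x * indicator A x / Z \<partial>lborel)"
    using nonneg pos integrable
    by (intro nn_integral_eq_integral integrable_divide integrable_real_mult_indicator) (auto simp: less_imp_le)
  also have "(\<integral>x. f x * indicator A x / Z \<partial>lborel) = (\<integral>x. f x * indicator A x \<partial>lborel) / Z"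
    by simp
  finally show ?thesis .
qed

lemma integral_indicator_nonneg: "0 \<le> (\<integral>x. f x * indicator A x \<partial>lborel)"
  using nonneg by (intro integral_nonneg_AE AE_I2) auto

lemma measure_eq: "A \<in> sets borel \<Longrightarrow> measure M A = (\<integral>x. f x * indicator A x \<partial>lborel) / Z"
  unfolding measure_def using emeasure_eq integral_indicator_nonneg pos by simp

lemma real_distribution: "real_distribution M"
proof -
  have "prob_space M"
  proof
    have "space M = UNIV" by (simp add: M_def)
    then show "emeasure M (space M) = 1" using emeasure_eq[of UNIV] pos by (simp add: Z_def)
  qed
  then show ?thesis
    unfolding real_distribution_def real_distribution_axioms_def by (simp add: M_def)
qed

lemma measure_singleton: "measure M {x} = 0"
proof -
  have "AE y in lborel. y \<noteq> x" by (rule AE_lborel_singleton)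
  then have "(\<integral>y. f y * indicator {x} y \<partial>lborel) = (\<integral>(y::real). 0 \<partial>lborel)"
    by (intro integral_cong_AE) (auto elim!: eventually_mono)
  then show ?thesis by (simp add: measure_eq)
qed

lemma cdf_eq: "cdf M a = (\<integral>x. f x * indicator {..<a} x \<partial>lborel) / Z"
proof -
  have "AE y in lborel. y \<noteq> a" by (rule AE_lborel_singleton)
  then have "(\<integral>x. f x * indicator {..a} x \<partial>lborel) = (\<integral>x. f x * indicator {..<a} x \<partial>lborel)"
    by (intro integral_cong_AE) (auto elim!: eventually_mono simp: indicator_def)
  then show ?thesis by (simp add: cdf_def measure_eq)
qed

lemma integral_below_quantile:
  assumes "0 < p" "p < 1"
  shows "(\<integral>x. f x * indicator {..<cdf_inverse M p} x \<partial>lborel) = p * Z"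
  using cdf_cdf_inverse[OF real_distribution measure_singleton assms] pos
  unfolding cdf_eq by (simp add: field_simps)

lemma bar_eq: "bar M = (\<integral>x. x * f x \<partial>lborel) / Z"
proof -
  have "bar M = (\<integral>x. (f x / Z) *\<^sub>R x \<partial>lborel)"
    unfolding bar_def M_def using nonneg pos by (intro integral_density) (auto simp: less_imp_le)
  also have "\<dots> = (\<integral>x. (x * f x) / Z \<partial>lborel)" by (simp add: mult.commute)
  finally show ?thesis by simp
qed

end

section \<open>The functional Santalo inequality\<close>

lemma ennreal_leI_real:
  fixes c :: real
  assumes c: "0 \<le> c" and le: "\<And>B. 0 \<le> B \<Longrightarrow> ennreal B \<le> x \<Longrightarrow> B \<le> c"
  shows "x \<le> ennreal c"
proof (cases x)
  case (real r)
  then show ?thesis using le[of r] by (simp add: ennreal_leI)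
next
  \<comment> \<open>An infinite \<open>x\<close> would have \<open>c + 1\<close> as a lower
    bound.\<close>
  case top
  then show ?thesis using le[of "c + 1"] c by simp
qed

lemma integral_gaussian_half:
  "(\<integral>r. exp (- r\<^sup>2 / 2) * indicator {0<..} r \<partial>lborel) = sqrt (pi / 2)"
  and integrable_gaussian: "integrable lborel (\<lambda>r::real. exp (- r\<^sup>2 / 2))"
proof -
  let ?g = "\<lambda>r::real. exp (- r\<^sup>2 / 2)"
  show i: "integrable lborel ?g" using integrable_exp_quadratic[of 1 0] by simp
  have "1 = (\<integral>r. std_normal_density r \<partial>lborel)" by (simp add: integral_normal_density)
  also have "\<dots> = (\<integral>r. 1 / sqrt (2 * pi) * ?g r \<partial>lborel)"
    unfolding std_normal_density_def ..
  finally have tot: "(\<integral>r. ?g r \<partial>lborel) = sqrt (2 * pi)" by (simp add: field_simps)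
  have "(\<integral>r. ?g r * indicator {..<0} r \<partial>lborel) = (\<integral>r. ?g r * indicator {0<..} r \<partial>lborel)"
    using integral_reflect[of "\<lambda>r. ?g r * indicator {0<..} r"]
    by (simp add: indicator_def)
  then have "2 * (\<integral>r. ?g r * indicator {0<..} r \<partial>lborel) = sqrt (2 * pi)"
    using integral_split_at[OF i, of 0] tot by simp
  moreover have "sqrt (2 * pi) = 2 * sqrt (pi / 2)"
    by (rule real_sqrt_unique) (simp_all add: power_mult_distrib)
  ultimately show "(\<integral>r. ?g r * indicator {0<..} r \<partial>lborel) = sqrt (pi / 2)" by simp
qed

text \<open>Translating \<open>\<phi>\<close> by \<open>a\<close> and tilting \<open>\<psi>\<close>
  by \<open>exp (a * y)\<close> turns the product bound into \<open>exp (- (s * t))\<close>, the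
  square of a Gaussian at the geometric mean. The half-line Gaussian integral
  \<open>sqrt (pi / 2)\<close> supplies the constant.\<close>

lemma santalo_half_line:
  fixes \<phi> \<psi> :: "real \<Rightarrow> real" and a :: real
  assumes [measurable]: "\<phi> \<in> borel_measurable borel" "\<psi> \<in> borel_measurable borel"
    and \<phi>0: "\<And>x. 0 \<le> \<phi> x" and \<psi>0: "\<And>x. 0 \<le> \<psi> x"
    and i\<phi>: "integrable lborel \<phi>"
    and le: "\<And>x y. \<phi> x * \<psi> y \<le> exp (- (x * y))"
  defines "M \<equiv> (\<integral>x. \<phi> x * indicator {a<..} x \<partial>lborel)"
  assumes M: "0 < M"
  shows "(\<integral>\<^sup>+y. ennreal (\<psi> y * exp (a * y) * indicator {0<..} y) \<partial>lborel) \<le> ennreal (pi / (2 * M))"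
proof (rule ennreal_leI_real)
  show "0 \<le> pi / (2 * M)" using M by simp
  \<comment> \<open>The tilted integral could be infinite, so Prekopa-Leindler is applied to its
    finite lower bounds.\<close>
  fix B :: real
  assume B: "0 \<le> B" "ennreal B \<le> (\<integral>\<^sup>+y. ennreal (\<psi> y * exp (a * y) * indicator {0<..} y) \<partial>lborel)"
  have "ennreal (sqrt (M * B)) \<le> (\<integral>\<^sup>+r. ennreal (exp (- r\<^sup>2 / 2) * indicator {0<..} r) \<partial>lborel)"
  proof (rule prekopa_leindler_geometric[where f="\<lambda>s. \<phi> (a + 1 * s)" and g="\<lambda>y. \<psi> y * exp (a * y)" and C=1])
    show "r * exp (- r\<^sup>2 / 2) \<le> 1" if "0 < r" for r :: real
    proof -
      have "r \<le> 1 + r\<^sup>2 / 2" using zero_le_power2[of "r - 1"] by (simp add: power2_diff)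
      also have "\<dots> \<le> exp (r\<^sup>2 / 2)" by (rule exp_ge_add_one_self)
      finally have "r * exp (- r\<^sup>2 / 2) \<le> exp (r\<^sup>2 / 2) * exp (- r\<^sup>2 / 2)" by (intro mult_right_mono) auto
      then show ?thesis by (simp add: mult_exp_exp)
    qed
    show "\<phi> (a + 1 * s) * (\<psi> t * exp (a * t)) \<le> (exp (- (sqrt (s * t))\<^sup>2 / 2))\<^sup>2" if "0 < s" "0 < t" for s t
    proof -
      have "\<phi> (a + s) * \<psi> t * exp (a * t) \<le> exp (- ((a + s) * t)) * exp (a * t)"
        by (intro mult_right_mono le) auto
      also have "\<dots> = exp (- (s * t))" by (simp add: mult_exp_exp algebra_simps)
      also have "\<dots> = (exp (- (sqrt (s * t))\<^sup>2 / 2))\<^sup>2" using that by (simp add: exp_double[symmetric])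
      finally show ?thesis by (simp add: mult.assoc)
    qed
    have "ennreal M = (\<integral>\<^sup>+x. ennreal (\<phi> x * indicator {a<..} x) \<partial>lborel)"
      unfolding M_def using i\<phi> \<phi>0
      by (intro nn_integral_eq_integral[symmetric] integrable_real_mult_indicator) auto
    also have "\<dots> = ennreal \<bar>1\<bar> * (\<integral>\<^sup>+s. ennreal (\<phi> (a + 1 * s) * indicator {a<..} (a + 1 * s)) \<partial>lborel)"
      by (rule nn_integral_real_affine) auto
    also have "\<dots> = (\<integral>\<^sup>+s. ennreal (\<phi> (a + 1 * s) * indicator {0<..} s) \<partial>lborel)"
      by (auto intro!: nn_integral_cong simp: indicator_def)
    finally show "ennreal M \<le> (\<integral>\<^sup>+s. ennreal (\<phi> (a + 1 * s) * indicator {0<..} s) \<partial>lborel)" by simp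
  qed (use \<phi>0 \<psi>0 M B in auto)
  also have "\<dots> = ennreal (sqrt (pi / 2))"
    unfolding integral_gaussian_half[symmetric]
    by (intro nn_integral_eq_integral integrable_real_mult_indicator integrable_gaussian) auto
  finally have "M * B \<le> pi / 2" by simp
  then show "B \<le> pi / (2 * M)" using M by (simp add: field_simps)
qed

text \<open>At a median \<open>a\<close> each side of \<open>\<phi>\<close> has mass
  \<open>Z / 2\<close>, so each half-line of the tilted \<open>\<psi>\<close> contributes at most
  \<open>pi / Z\<close>. The negative half-line is handled by reflection.\<close>

lemma santalo_median:
  fixes \<phi> \<psi> :: "real \<Rightarrow> real" and a :: real
  assumes [measurable]: "\<phi> \<in> borel_measurable borel" "\<psi> \<in> borel_measurable borel"
    and \<phi>0: "\<And>x. 0 \<le> \<phi> x" and \<psi>0: "\<And>x. 0 \<le> \<psi> x"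
    and i\<phi>: "integrable lborel \<phi>"
    and le: "\<And>x y. \<phi> x * \<psi> y \<le> exp (- (x * y))"
  defines "Z \<equiv> (\<integral>x. \<phi> x \<partial>lborel)"
  assumes Z: "0 < Z" and a: "(\<integral>x. \<phi> x * indicator {..<a} x \<partial>lborel) = Z / 2"
  shows "(\<integral>\<^sup>+y. ennreal (\<psi> y * exp (a * y)) \<partial>lborel) \<le> ennreal (2 * pi / Z)"
proof -
  have up: "(\<integral>x. \<phi> x * indicator {a<..} x \<partial>lborel) = Z / 2"
    using integral_split_at[OF i\<phi>, of a] a by (simp add: Z_def)
  define \<phi>' where "\<phi>' x = \<phi> (- x)" for x
  define \<psi>' where "\<psi>' x = \<psi> (- x)" for x
  have [measurable]: "\<phi>' \<in> borel_measurable borel" "\<psi>' \<in> borel_measurable borel"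
    unfolding \<phi>'_def \<psi>'_def by measurable
  have "(\<integral>x. \<phi>' x * indicator {- a<..} x \<partial>lborel) = (\<integral>x. \<phi> x * indicator {..<a} x \<partial>lborel)"
    using integral_reflect[of "\<lambda>x. \<phi>' x * indicator {- a<..} x"]
    by (simp add: \<phi>'_def indicator_def)
  then have low: "(\<integral>x. \<phi>' x * indicator {- a<..} x \<partial>lborel) = Z / 2" using a by simp
  have "AE y in lborel. y \<noteq> (0::real)" by (rule AE_lborel_singleton)
  then have "(\<integral>\<^sup>+y. ennreal (\<psi> y * exp (a * y)) \<partial>lborel)
     = (\<integral>\<^sup>+y. ennreal (\<psi> y * exp (a * y) * indicator {0<..} y) + ennreal (\<psi> y * exp (a * y) * indicator {..<0} y) \<partial>lborel)"
    by (intro nn_integral_cong_AE) (auto elim!: eventually_mono simp: indicator_def)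
  also have "\<dots> = (\<integral>\<^sup>+y. ennreal (\<psi> y * exp (a * y) * indicator {0<..} y) \<partial>lborel)
      + (\<integral>\<^sup>+y. ennreal (\<psi> y * exp (a * y) * indicator {..<0} y) \<partial>lborel)"
    by (rule nn_integral_add) auto
  also have "(\<integral>\<^sup>+y. ennreal (\<psi> y * exp (a * y) * indicator {..<0} y) \<partial>lborel)
      = ennreal \<bar>-1\<bar> * (\<integral>\<^sup>+y. ennreal (\<psi> (0 + -1 * y) * exp (a * (0 + -1 * y)) * indicator {..<0} (0 + -1 * y)) \<partial>lborel)"
    by (rule nn_integral_real_affine) auto
  also have "\<dots> = (\<integral>\<^sup>+y. ennreal (\<psi>' y * exp (- a * y) * indicator {0<..} y) \<partial>lborel)"
    by (auto intro!: nn_integral_cong simp: indicator_def \<psi>'_def)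
  also have "(\<integral>\<^sup>+y. ennreal (\<psi> y * exp (a * y) * indicator {0<..} y) \<partial>lborel)
      + (\<integral>\<^sup>+y. ennreal (\<psi>' y * exp (- a * y) * indicator {0<..} y) \<partial>lborel)
      \<le> ennreal (pi / (2 * (Z / 2))) + ennreal (pi / (2 * (Z / 2)))"
  proof (rule add_mono)
    show "(\<integral>\<^sup>+y. ennreal (\<psi> y * exp (a * y) * indicator {0<..} y) \<partial>lborel) \<le> ennreal (pi / (2 * (Z / 2)))"
      using santalo_half_line[of \<phi> \<psi> a] \<phi>0 \<psi>0 i\<phi> le Z unfolding up by simp
    have "\<phi>' x * \<psi>' y \<le> exp (- (x * y))" for x y using le[of "-x" "-y"] by (simp add: \<phi>'_def \<psi>'_def)
    moreover have "integrable lborel \<phi>'" unfolding \<phi>'_def by (rule integrable_reflect[OF i\<phi>])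
    ultimately show "(\<integral>\<^sup>+y. ennreal (\<psi>' y * exp (- a * y) * indicator {0<..} y) \<partial>lborel) \<le> ennreal (pi / (2 * (Z / 2)))"
      using santalo_half_line[of \<phi>' \<psi>' "- a"] \<phi>0 \<psi>0 Z unfolding low by (simp add: \<phi>'_def \<psi>'_def)
  qed
  also have "\<dots> = ennreal (2 * pi / Z)"
    using Z by (simp add: ennreal_plus[symmetric] del: ennreal_plus)
  finally show ?thesis .
qed

text \<open>The function whose median is used is the tilt of \<open>\<psi>\<close>, so that only the vanishing
  barycentre of the translate of \<open>\<phi>\<close> matters; the tilt need not be integrable, hence the truncation.\<close>

theorem santalo_barycentres:
  fixes \<phi> \<psi> :: "real \<Rightarrow> real"
  assumes [measurable]: "\<phi> \<in> borel_measurable borel" "\<psi> \<in> borel_measurable borel"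
    and \<phi>0: "\<And>x. 0 \<le> \<phi> x" and \<psi>0: "\<And>x. 0 \<le> \<psi> x"
    and i\<phi>: "integrable lborel \<phi>" "integrable lborel (\<lambda>x. x * \<phi> x)"
    and i\<psi>: "integrable lborel \<psi>" "integrable lborel (\<lambda>x. x * \<psi> x)"
    and le: "\<And>x y. \<phi> x * \<psi> y \<le> exp (- (x * y))"
  defines "Z\<phi> \<equiv> (\<integral>x. \<phi> x \<partial>lborel)" and "Z\<psi> \<equiv> (\<integral>x. \<psi> x \<partial>lborel)"
  assumes Z: "0 < Z\<phi>" "0 < Z\<psi>"
  shows "Z\<phi> * Z\<psi> \<le> 2 * pi * exp (- ((\<integral>x. x * \<phi> x \<partial>lborel) / Z\<phi> * ((\<integral>x. x * \<psi> x \<partial>lborel) / Z\<psi>)))"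
proof -
  \<comment> \<open>Translation by the barycentre \<open>c\<close> of \<open>\<phi>\<close> produces
    \<open>u\<close> with mean zero; the tilt of \<open>\<psi>\<close> by \<open>exp (c * y)\<close>
    compensates in the product bound.\<close>
  define c where "c = (\<integral>x. x * \<phi> x \<partial>lborel) / Z\<phi>"
  define u where "u x = \<phi> (c + 1 * x)" for x
  have [measurable]: "u \<in> borel_measurable borel" unfolding u_def by measurable
  have u0: "0 \<le> u x" for x by (simp add: u_def \<phi>0)
  have iu: "integrable lborel u" unfolding u_def by (rule lborel_integrable_real_affine[OF i\<phi>(1)]) simp
  have "integrable lborel (\<lambda>x. (c + 1 * x) * \<phi> (c + 1 * x))" by (rule lborel_integrable_real_affine[OF i\<phi>(2)]) simp
  then have "integrable lborel (\<lambda>x. (c + 1 * x) * \<phi> (c + 1 * x) - c * u x)"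
    using iu by (intro Bochner_Integration.integrable_diff integrable_mult_right)
  then have ixu: "integrable lborel (\<lambda>x. x * u x)" by (simp add: u_def algebra_simps)
  have Zu: "(\<integral>x. u x \<partial>lborel) = Z\<phi>"
    unfolding Z\<phi>_def u_def using lborel_integral_real_affine[of 1 \<phi> c] by simp
  have "c * Z\<phi> = (\<integral>x. (c + 1 * x) * \<phi> (c + 1 * x) \<partial>lborel)"
    using lborel_integral_real_affine[of 1 "\<lambda>x. x * \<phi> x" c] Z by (simp add: c_def)
  also have "\<dots> = (\<integral>x. c * u x + x * u x \<partial>lborel)" by (simp add: u_def algebra_simps)
  also have "\<dots> = c * Z\<phi> + (\<integral>x. x * u x \<partial>lborel)"
    using iu ixu Zu by simp
  finally have mean0: "(\<integral>x. x * u x \<partial>lborel) = 0" by simp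
  define v where "v n y = \<psi> y * exp (c * y) * indicator {- real n..real n} y" for n y
  have [measurable]: "v n \<in> borel_measurable borel" for n unfolding v_def by measurable
  have v0: "0 \<le> v n y" for n y by (simp add: v_def \<psi>0)
  have iv: "integrable lborel (v n)" for n
  proof (rule Bochner_Integration.integrable_bound)
    show "integrable lborel (\<lambda>y. exp (\<bar>c\<bar> * real n) * \<psi> y)" by (intro integrable_mult_right i\<psi>)
    show "AE y in lborel. norm (v n y) \<le> norm (exp (\<bar>c\<bar> * real n) * \<psi> y)"
    proof (rule AE_I2)
      fix y :: real
      show "norm (v n y) \<le> norm (exp (\<bar>c\<bar> * real n) * \<psi> y)"
      proof (cases "y \<in> {- real n..real n}")
        case True
        have "c * y \<le> \<bar>c\<bar> * \<bar>y\<bar>" by (metis abs_ge_self abs_mult)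
        also have "\<dots> \<le> \<bar>c\<bar> * real n" using True by (intro mult_left_mono) auto
        finally have "\<psi> y * exp (c * y) \<le> \<psi> y * exp (\<bar>c\<bar> * real n)" using \<psi>0 by (intro mult_left_mono) auto
        then show ?thesis using True \<psi>0[of y] by (simp add: v_def mult.commute)
      qed (simp add: v_def)
    qed
  qed simp
  have bound: "(\<integral>y. v n y \<partial>lborel) \<le> 2 * pi / Z\<phi>" for n
  proof (cases "0 < (\<integral>y. v n y \<partial>lborel)")
    case True
    interpret v: lebesgue_density "v n" "\<integral>y. v n y \<partial>lborel" "density lborel (\<lambda>y. ennreal (v n y / (\<integral>y. v n y \<partial>lborel)))"
      by unfold_locales (simp_all add: v0 iv True)
    \<comment> \<open>A median of the truncated tilt; \<open>santalo_median\<close> is used below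
      with the two functions exchanged.\<close>
    obtain b where b: "(\<integral>y. v n y * indicator {..<b} y \<partial>lborel) = (\<integral>y. v n y \<partial>lborel) / 2"
      using v.integral_below_quantile[of "1/2"] by auto
    have vu: "v n y * u x \<le> exp (- (y * x))" for y x
    proof -
      have "\<phi> (c + x) * \<psi> y * exp (c * y) \<le> exp (- ((c + x) * y)) * exp (c * y)"
        by (intro mult_right_mono le) auto
      also have "\<dots> = exp (- (y * x))" by (simp add: mult_exp_exp algebra_simps)
      finally show ?thesis by (simp add: v_def u_def indicator_def mult_ac)
    qed
    \<comment> \<open>Since \<open>u\<close> has mean zero, Jensen shows that tilting it by
      \<open>exp (b * x)\<close> does not lower its mass, whatever the median \<open>b\<close>
      is.\<close>
    have "ennreal Z\<phi> \<le> (\<integral>\<^sup>+x. ennreal (u x * exp (b * x)) \<partial>lborel)"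
      using tilted_integral_ge[of u b] u0 iu ixu Z unfolding Zu mean0 by simp
    also have "\<dots> \<le> ennreal (2 * pi / (\<integral>y. v n y \<partial>lborel))"
      by (rule santalo_median[OF _ _ v0 u0 iv vu True b]) auto
    finally have "Z\<phi> \<le> 2 * pi / (\<integral>y. v n y \<partial>lborel)" using True by simp
    then show ?thesis using True Z by (simp add: field_simps)
  next
    case False
    moreover have "0 \<le> 2 * pi / Z\<phi>" using Z by simp
    ultimately show ?thesis by linarith
  qed
  \<comment> \<open>A second use of Jensen removes the tilt of \<open>\<psi>\<close> and produces
    the product of the two barycentres in the exponent.\<close>
  have "ennreal (Z\<psi> * exp (c * (\<integral>x. x * \<psi> x \<partial>lborel) / Z\<psi>)) \<le> (\<integral>\<^sup>+y. ennreal (\<psi> y * exp (c * y)) \<partial>lborel)"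
    unfolding Z\<psi>_def by (rule tilted_integral_ge) (use \<psi>0 i\<psi> Z in \<open>auto simp: Z\<psi>_def\<close>)
  also have "\<dots> = (\<integral>\<^sup>+y. (SUP n. ennreal (v n y)) \<partial>lborel)"
  proof (rule nn_integral_cong)
    fix y :: real
    obtain n where n: "\<bar>y\<bar> \<le> real n" using real_arch_simple by blast
    then have "ennreal (\<psi> y * exp (c * y)) \<le> (SUP n. ennreal (v n y))"
      by (intro SUP_upper2[of n]) (auto simp: v_def abs_le_iff indicator_def)
    then show "ennreal (\<psi> y * exp (c * y)) = (SUP n. ennreal (v n y))"
      by (intro antisym SUP_least) (auto simp: v_def indicator_def \<psi>0)
  qed
  also have "\<dots> = (SUP n. \<integral>\<^sup>+y. ennreal (v n y) \<partial>lborel)"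
  proof (rule nn_integral_monotone_convergence_SUP)
    show "incseq (\<lambda>n y. ennreal (v n y))"
      by (intro incseq_SucI le_funI ennreal_leI) (auto simp: v_def indicator_def \<psi>0)
  qed simp
  also have "\<dots> \<le> ennreal (2 * pi / Z\<phi>)"
    by (rule SUP_least) (use bound v0 iv in \<open>auto simp: nn_integral_eq_integral intro!: ennreal_leI\<close>)
  finally have "Z\<psi> * exp (c * (\<integral>x. x * \<psi> x \<partial>lborel) / Z\<psi>) \<le> 2 * pi / Z\<phi>" using Z by simp
  then have "Z\<phi> * Z\<psi> * exp (c * ((\<integral>x. x * \<psi> x \<partial>lborel) / Z\<psi>)) \<le> 2 * pi"
    using Z by (simp add: field_simps)
  then show ?thesis
    unfolding c_def[symmetric] by (simp add: exp_minus field_simps)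
qed

subsection \<open>Gibbs measures\<close>

text \<open>The real-valued form of \<open>ext_exp (ereal k * F x)\<close>. At the value
  \<open>\<infinity>\<close> it would wrongly give 1, since \<open>real_of_ereal\<close> is 0 there;
  \<open>cost_dominated_finite\<close> excludes that value.\<close>

definition weight :: "real \<Rightarrow> (real \<Rightarrow> ereal) \<Rightarrow> real \<Rightarrow> real" where
  "weight k F x = (if F x = -\<infinity> then 0 else exp (k * real_of_ereal (F x)))"

lemma weight_nonneg: "0 \<le> weight k F x"
  by (simp add: weight_def)

lemma weight_borel[measurable]: "F \<in> borel_measurable borel \<Longrightarrow> weight k F \<in> borel_measurable borel"
proof -
  assume [measurable]: "F \<in> borel_measurable borel"
  have "{x \<in> space borel. F x \<in> {- \<infinity>}} \<in> sets borel" by measurable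
  then have [measurable]: "Measurable.pred borel (\<lambda>x. F x = - \<infinity>)" by (simp add: pred_def)
  show ?thesis unfolding weight_def by measurable
qed

lemma ext_exp_eq_weight:
  assumes "0 < k" "F x \<noteq> \<infinity>"
  shows "ext_exp (ereal k * F x) = ennreal (weight k F x)"
  using assms by (cases "F x") (auto simp: ext_exp_def weight_def zero_ereal_def)

text \<open>The diagonal \<open>x = y\<close> suffices: under the \<open>ereal\<close> convention a
  summand \<open>\<infinity>\<close> makes the sum \<open>\<infinity>\<close>, even next to
  \<open>- \<infinity>\<close>.\<close>

lemma cost_dominated_finite:
  assumes "cost_dominated F G"
  shows "F x \<noteq> \<infinity>" "G x \<noteq> \<infinity>"
proof -
  have "F x + G x \<le> ereal ((x - x)\<^sup>2 / 2)" using assms unfolding cost_dominated_def by blast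
  then show "F x \<noteq> \<infinity>" "G x \<noteq> \<infinity>" by (cases "F x"; cases "G x"; auto)+
qed

lemma weight_mult_le:
  assumes k: "0 < k" and FG: "cost_dominated F G"
  shows "weight k F x * weight k G y \<le> exp (k * ((x - y)\<^sup>2 / 2))"
proof -
  have "F x + G y \<le> ereal ((x - y)\<^sup>2 / 2)" using FG unfolding cost_dominated_def by blast
  then show ?thesis
    using k cost_dominated_finite[OF FG]
    by (cases "F x"; cases "G y") (auto simp: weight_def mult_exp_exp distrib_left[symmetric])
qed

text \<open>A bridge from the \<open>ennreal\<close> conditions on \<open>F\<close> under
  \<open>m\<close> to Bochner integrals on the line; \<open>\<phi>\<close> is the unnormalised
  Lebesgue density of the tilt.\<close>

locale tilted_density =
  fixes k :: real and m :: "real measure" and q :: "real \<Rightarrow> real" and F :: "real \<Rightarrow> ereal"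
    and \<phi> :: "real \<Rightarrow> real" and Z :: real
  assumes k: "0 < k" and m: "m = density lborel (\<lambda>x. ennreal (q x))"
    and q_borel[measurable]: "q \<in> borel_measurable borel" and q0: "\<And>x. 0 \<le> q x"
    and adm: "admissible k m F" and fin: "\<And>x. F x \<noteq> \<infinity>"
    and \<phi>_def: "\<phi> = (\<lambda>x. weight k F x * q x)" and Z_def: "Z = (\<integral>x. \<phi> x \<partial>lborel)"
begin

lemma F_borel[measurable]: "F \<in> borel_measurable borel"
  using adm by (simp add: admissible_def)

lemma phi_borel[measurable]: "\<phi> \<in> borel_measurable borel"
  unfolding \<phi>_def by measurable

lemma phi_nonneg: "0 \<le> \<phi> x"
  unfolding \<phi>_def using q0 weight_nonneg by simp

lemma nn_integral_weight:
  assumes [measurable]: "u \<in> borel_measurable borel" and "\<And>x. 0 \<le> u x"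
  shows "(\<integral>\<^sup>+x. ennreal (u x) * ext_exp (ereal k * F x) \<partial>m) = (\<integral>\<^sup>+x. ennreal (u x * \<phi> x) \<partial>lborel)"
  unfolding m ext_exp_eq_weight[where F=F, OF k fin] using assms(2) q0 weight_nonneg
  by (subst nn_integral_density) (auto simp: \<phi>_def ennreal_mult mult_ac intro!: nn_integral_cong)

lemma mass_eq_nn_integral: "mass k m F = (\<integral>\<^sup>+x. ennreal (\<phi> x) \<partial>lborel)"
  unfolding mass_def using nn_integral_weight[of "\<lambda>_. 1"] by simp

lemma integrable_phi: "integrable lborel \<phi>"
  using adm phi_nonneg unfolding admissible_def mass_eq_nn_integral by (intro integrableI_nonneg) auto

lemma integrable_ident_phi: "integrable lborel (\<lambda>x. x * \<phi> x)"
proof (rule Bochner_Integration.integrable_bound)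
  have "integrable lborel (\<lambda>x. x\<^sup>2 * \<phi> x)"
    using adm phi_nonneg nn_integral_weight[of "\<lambda>x. x\<^sup>2"] unfolding admissible_def
    by (intro integrableI_nonneg) auto
  then show "integrable lborel (\<lambda>x. \<phi> x + x\<^sup>2 * \<phi> x)"
    by (intro Bochner_Integration.integrable_add integrable_phi)
  show "AE x in lborel. norm (x * \<phi> x) \<le> norm (\<phi> x + x\<^sup>2 * \<phi> x)"
  proof (rule AE_I2)
    fix x :: real
    have "\<bar>x\<bar> \<le> 1 + x\<^sup>2" by (rule abs_le_one_plus_square)
    then have "\<bar>x\<bar> * \<phi> x \<le> (1 + x\<^sup>2) * \<phi> x" by (rule mult_right_mono[OF _ phi_nonneg])
    then show "norm (x * \<phi> x) \<le> norm (\<phi> x + x\<^sup>2 * \<phi> x)"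
      using phi_nonneg[of x] by (simp add: abs_mult algebra_simps)
  qed
qed simp

lemma mass_eq: "mass k m F = ennreal Z"
  unfolding mass_eq_nn_integral Z_def using phi_nonneg by (intro nn_integral_eq_integral integrable_phi) auto

lemma Z_pos: "0 < Z"
  using adm unfolding admissible_def mass_eq by simp

sublocale lebesgue_density \<phi> Z "tilt k m F"
proof
  show "tilt k m F = density lborel (\<lambda>x. ennreal (\<phi> x / Z))"
    unfolding tilt_def mass_eq ext_exp_eq_weight[where F=F, OF k fin] unfolding m using q0 weight_nonneg Z_pos
    by (subst density_density_eq)
      (auto simp: \<phi>_def divide_ennreal ennreal_mult[symmetric] mult_ac intro!: density_cong)
qed (use phi_nonneg integrable_phi Z_pos Z_def in auto)

end

lemma continuous_AE_eq_imp_eq: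
  fixes f g :: "real \<Rightarrow> real"
  assumes f: "continuous_on UNIV f" and g: "continuous_on UNIV g" and ae: "AE x in lborel. f x = g x"
  shows "f = g"
proof (rule ccontr)
  assume "f \<noteq> g"
  then obtain x where x: "f x \<noteq> g x" by auto
  have "open {x. f x \<noteq> g x}" by (rule open_Collect_neq[OF f g])
  then obtain e where e: "e > 0" "ball x e \<subseteq> {x. f x \<noteq> g x}" using x open_contains_ball by blast
  have "AE y in lborel. y \<notin> {x - e<..<x + e}"
    using ae by (rule eventually_mono) (use e(2) in \<open>auto simp: ball_eq_greaterThanLessThan\<close>)
  then show False using e(1) not_AE_notin_interval[of "x - e" "x + e"] by simp
qed

text \<open>Two continuous densities of the same measure agree almost everywhere, hence everywhere.
  Every candidate in the definite description therefore maximises \<open>exp (- V x)\<close>, and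
  the strict minimum of \<open>V\<close> singles out 0.\<close>

lemma mode_gibbs_measure:
  assumes cont: "continuous_on UNIV V" and min: "\<And>x. x \<noteq> 0 \<Longrightarrow> V 0 < V x"
    and prob: "prob_space (gibbs_measure V)"
  shows "mode (gibbs_measure V) = 0"
  unfolding mode_def
proof (rule the_equality)
  have V_borel[measurable]: "V \<in> borel_measurable borel" by (rule borel_measurable_continuous_onI[OF cont])
  have le: "V 0 \<le> V x" for x using min[of x] by (cases "x = 0") auto
  show "\<exists>p. continuous_on UNIV p \<and> (\<forall>y. 0 \<le> p y) \<and>
       gibbs_measure V = density lborel (\<lambda>y. ennreal (p y)) \<and> (\<forall>y. p y \<le> p 0)"
    by (rule exI[of _ "\<lambda>x. exp (- V x)"]) (auto simp: gibbs_measure_def le intro!: continuous_intros cont)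
  fix \<xi> assume "\<exists>p. continuous_on UNIV p \<and> (\<forall>y. 0 \<le> p y) \<and>
       gibbs_measure V = density lborel (\<lambda>y. ennreal (p y)) \<and> (\<forall>y. p y \<le> p \<xi>)"
  then obtain p where p: "continuous_on UNIV p" "\<And>y. 0 \<le> p y"
    "gibbs_measure V = density lborel (\<lambda>y. ennreal (p y))" "\<And>y. p y \<le> p \<xi>" by auto
  have [measurable]: "p \<in> borel_measurable borel" by (rule borel_measurable_continuous_onI[OF p(1)])
  have "AE x in lborel. ennreal (exp (- V x)) = ennreal (p x)"
    using p(3) unfolding gibbs_measure_def
    by (subst (asm) sigma_finite_measure.density_unique_iff[OF sigma_finite_lborel]) auto
  then have "AE x in lborel. exp (- V x) = p x" by (rule eventually_mono) (simp add: p(2))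
  then have "(\<lambda>x. exp (- V x)) = p"
    by (intro continuous_AE_eq_imp_eq p(1) continuous_intros cont)
  then have "exp (- V 0) \<le> exp (- V \<xi>)" using p(4)[of 0] by (simp add: fun_eq_iff)
  then show "\<xi> = 0" using min[of \<xi>] by (cases "\<xi> = 0") auto
qed

text \<open>Subtracting the quadratic leaves second derivative \<open>deriv (deriv V) x - k\<close>,
  which is nonnegative. As 0 minimises \<open>V\<close>, the tangent of the difference at 0 is
  horizontal, so 0 minimises the difference as well.\<close>

lemma kappa_convex_decomposition:
  assumes smooth: "smooth V" and conv: "kappa_convex k V" and min: "\<And>x. V 0 \<le> V x"
  shows "convex_on UNIV (\<lambda>x. V x - k * x\<^sup>2 / 2)" and "continuous_on UNIV V"
    and "V 0 \<le> V x - k * x\<^sup>2 / 2"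
proof -
  have d1: "(V has_real_derivative deriv V x) (at x)" for x
    using smooth[unfolded smooth_def, rule_format, of 0 x] by (simp add: DERIV_deriv_iff_field_differentiable)
  have d2: "(deriv V has_real_derivative deriv (deriv V) x) (at x)" for x
    using smooth[unfolded smooth_def, rule_format, of 1 x] by (simp add: DERIV_deriv_iff_field_differentiable)
  show "continuous_on UNIV V" using d1 by (meson DERIV_isCont continuous_at_imp_continuous_on)
  have e1: "((\<lambda>x. V x - k * x\<^sup>2 / 2) has_real_derivative (deriv V x - k * x)) (at x)" for x
    by (auto intro!: derivative_eq_intros d1)
  show conv: "convex_on UNIV (\<lambda>x. V x - k * x\<^sup>2 / 2)"
  proof (rule f''_ge0_imp_convex[OF _ e1])
    show "((\<lambda>x. deriv V x - k * x) has_real_derivative (deriv (deriv V) x - k)) (at x)" for x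
      by (auto intro!: derivative_eq_intros d2)
    show "0 \<le> deriv (deriv V) x - k" for x using conv by (simp add: kappa_convex_def)
  qed simp
  have "deriv V 0 = 0" by (rule DERIV_local_min[OF d1, of 1]) (use min in auto)
  then have "((\<lambda>x. V x - k * x\<^sup>2 / 2) has_real_derivative 0) (at 0)" using e1[of 0] by simp
  from convex_on_imp_above_tangent[OF conv _ _ _ this, of x]
  show "V 0 \<le> V x - k * x\<^sup>2 / 2" by simp
qed

theorem gibbs_mass_bound:
  assumes k: "0 < k" and smooth: "smooth V" and conv: "kappa_convex k V"
    and m: "m = gibbs_measure V" and prob: "prob_space m" and min: "\<And>x. V 0 \<le> V x"
    and F: "admissible k m F" and G: "admissible k m G" and FG: "cost_dominated F G"
  shows "mass k m F * mass k m G \<le> ennreal (exp (k * Phi k m F G))"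
proof -
  define W where "W x = V x - k * x\<^sup>2 / 2" for x
  note dec = kappa_convex_decomposition[OF smooth conv min]
  have W: "convex_on UNIV W" using dec(1) by (simp add: W_def[abs_def])
  have W0: "W 0 \<le> W x" for x using dec(3) by (simp add: W_def)
  have [measurable]: "V \<in> borel_measurable borel" by (rule borel_measurable_continuous_onI[OF dec(2)])
  define q where "q x = exp (- V x)" for x
  have q_W: "q = (\<lambda>x. exp (- k * x\<^sup>2 / 2 - W x))" by (simp add: q_def W_def fun_eq_iff)
  have [measurable]: "q \<in> borel_measurable borel" unfolding q_def by measurable
  have m_q: "m = density lborel (\<lambda>x. ennreal (q x))" by (simp add: m gibbs_measure_def q_def)
  have q0: "0 \<le> q x" for x by (simp add: q_def)
  have q_le: "q x \<le> exp (- W 0) * exp (0 * x - k * x\<^sup>2 / 2)" for x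
    using W0[of x] by (simp add: q_W mult_exp_exp)
  have iq: "integrable lborel q"
  proof (rule Bochner_Integration.integrable_bound)
    show "integrable lborel (\<lambda>x. exp (- W 0) * exp (0 * x - k * x\<^sup>2 / 2))"
      by (intro integrable_mult_right integrable_exp_quadratic k)
    show "AE x in lborel. norm (q x) \<le> norm (exp (- W 0) * exp (0 * x - k * x\<^sup>2 / 2))"
      using q_le by (intro AE_I2) (simp add: q_def)
  qed simp
  have ixq: "integrable lborel (\<lambda>x. x * q x)"
  proof (rule Bochner_Integration.integrable_bound)
    show "integrable lborel (\<lambda>x. q x + exp (- W 0) * (x\<^sup>2 * exp (0 * x - k * x\<^sup>2 / 2)))"
      by (intro Bochner_Integration.integrable_add iq integrable_mult_right integrable_square_exp_quadratic k)
    show "AE x in lborel. norm (x * q x) \<le> norm (q x + exp (- W 0) * (x\<^sup>2 * exp (0 * x - k * x\<^sup>2 / 2)))"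
    proof (rule AE_I2)
      fix x :: real
      have "\<bar>x\<bar> \<le> 1 + x\<^sup>2" by (rule abs_le_one_plus_square)
      then have "\<bar>x\<bar> * q x \<le> (1 + x\<^sup>2) * q x" by (rule mult_right_mono[OF _ q0])
      also have "\<dots> = q x + x\<^sup>2 * q x" by (simp add: algebra_simps)
      also have "\<dots> \<le> q x + x\<^sup>2 * (exp (- W 0) * exp (0 * x - k * x\<^sup>2 / 2))"
        by (intro add_left_mono mult_left_mono q_le) auto
      finally show "norm (x * q x) \<le> norm (q x + exp (- W 0) * (x\<^sup>2 * exp (0 * x - k * x\<^sup>2 / 2)))"
        using q0[of x] by (simp add: abs_mult mult_ac)
    qed
  qed simp
  have "ennreal (\<integral>x. q x \<partial>lborel) = emeasure m (space m)"
    using iq q0 unfolding m_q by (simp add: emeasure_density nn_integral_eq_integral)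
  also have "\<dots> = 1" by (rule prob_space.emeasure_space_1[OF prob])
  finally have int_q: "(\<integral>x. q x \<partial>lborel) = 1" by simp
  interpret q: lebesgue_density q 1 m
    by standard (simp_all add: iq int_q m_q, simp add: q_def)
  define p where "p = cdf m 0"
  have int_below: "(\<integral>x. q x * indicator {..<0} x \<partial>lborel) = p" using q.cdf_eq[of 0] by (simp add: p_def)
  have p: "0 < p" "p < 1"
  proof -
    \<comment> \<open>The density \<open>q\<close> is positive everywhere, so every set containing
      an interval of length 1 has positive mass; both half-lines do.\<close>
    have pos: "0 < (\<integral>x. q x * indicator S x \<partial>lborel)" if S: "S \<in> sets borel" "{c<..<c+1} \<subseteq> S" for S and c :: real
    proof (rule ccontr)
      assume "\<not> ?thesis"
      then have "(\<integral>x. q x * indicator S x \<partial>lborel) = 0" using q.integral_indicator_nonneg[of S] by linarith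
      then have "AE x in lborel. q x * indicator S x = 0"
        using integral_nonneg_eq_0_iff_AE[OF integrable_real_mult_indicator[OF _ iq, of S]] S q.nonneg by simp
      then have "AE x in lborel. x \<notin> {c<..<c+1}"
        by (rule eventually_mono) (use S in \<open>auto simp: q_def indicator_def\<close>)
      then show False using not_AE_notin_interval[of c "c + 1"] by simp
    qed
    have "0 < (\<integral>x. q x * indicator {..<0} x \<partial>lborel)" by (rule pos[of _ "-1"]) auto
    then show "0 < p" using int_below by simp
    have "0 < (\<integral>x. q x * indicator {0<..} x \<partial>lborel)" by (rule pos[of _ 0]) auto
    then show "p < 1" using integral_split_at[OF iq, of 0] int_below int_q by simp
  qed
  \<comment> \<open>The quadratic lower bound makes the minimum strict, which determines the
    mode.\<close>
  have "V 0 < V x" if "x \<noteq> 0" for x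
    using dec(3)[of x] k that by (smt (verit) divide_pos_pos mult_pos_pos zero_less_power2)
  then have mode: "mode m = 0"
    unfolding m by (intro mode_gibbs_measure dec(2)) (use prob m in auto)
  define \<phi> where "\<phi> = (\<lambda>x. weight k F x * q x)"
  define \<psi> where "\<psi> = (\<lambda>x. weight k G x * q x)"
  interpret F: tilted_density k m q F \<phi> "\<integral>x. \<phi> x \<partial>lborel"
    by standard (use k m_q F cost_dominated_finite[OF FG] q.nonneg in \<open>auto simp: \<phi>_def\<close>)
  interpret G: tilted_density k m q G \<psi> "\<integral>x. \<psi> x \<partial>lborel"
    by standard (use k m_q G cost_dominated_finite[OF FG] q.nonneg in \<open>auto simp: \<psi>_def\<close>)
  define a where "a = alpha m (tilt k m F)"
  define b where "b = alpha m (tilt k m G)"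
  \<comment> \<open>With mode 0, the transport map evaluated there is the quantile of the tilt at
    the level \<open>p = cdf m 0\<close>.\<close>
  have a: "a = cdf_inverse (tilt k m F) p" and b: "b = cdf_inverse (tilt k m G) p"
    by (simp_all add: a_def b_def alpha_def transport_map_def mode p_def)
  have le: "\<phi> x * \<psi> y \<le> exp (- k * x * y - W x - W y)" for x y
  proof -
    have "\<phi> x * \<psi> y = (weight k F x * weight k G y) * (q x * q y)" by (simp add: \<phi>_def \<psi>_def)
    also have "\<dots> \<le> exp (k * ((x - y)\<^sup>2 / 2)) * (q x * q y)"
      by (intro mult_right_mono weight_mult_le k FG) (simp add: q_def)
    \<comment> \<open>The squares in the cost cancel the Gaussian parts of \<open>q x\<close> and
      \<open>q y\<close>, leaving only the cross term.\<close>
    also have "\<dots> = exp (- k * x * y - W x - W y)"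
      by (simp add: q_W mult_exp_exp power2_eq_square field_simps)
    finally show ?thesis .
  qed
  have "ln (\<integral>x. \<phi> x \<partial>lborel) + ln (\<integral>x. \<psi> x \<partial>lborel)
      + k * (b * (\<integral>x. x * \<phi> x \<partial>lborel) / (\<integral>x. \<phi> x \<partial>lborel) + a * (\<integral>x. x * \<psi> x \<partial>lborel) / (\<integral>x. \<psi> x \<partial>lborel))
    \<le> k * (a * b + (a + b) * (\<integral>x. x * q x \<partial>lborel))"
    unfolding q_W
    by (rule two_sided_bound[OF k W W0 _ _ F.phi_nonneg G.phi_nonneg F.integrable_phi F.integrable_ident_phi
          G.integrable_phi G.integrable_ident_phi le F.Z_pos G.Z_pos p])
      (use iq ixq int_q int_below F.integral_below_quantile[OF p] G.integral_below_quantile[OF p] a b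
        in \<open>simp_all add: q_W\<close>)
  then have "ln (\<integral>x. \<phi> x \<partial>lborel) + ln (\<integral>x. \<psi> x \<partial>lborel) \<le> k * Phi k m F G"
    unfolding Phi_def Let_def a_def[symmetric] b_def[symmetric] F.bar_eq G.bar_eq q.bar_eq
    by (simp add: algebra_simps)
  then have "ln ((\<integral>x. \<phi> x \<partial>lborel) * (\<integral>x. \<psi> x \<partial>lborel)) \<le> k * Phi k m F G"
    using F.Z_pos G.Z_pos by (simp add: ln_mult)
  then have "exp (ln ((\<integral>x. \<phi> x \<partial>lborel) * (\<integral>x. \<psi> x \<partial>lborel))) \<le> exp (k * Phi k m F G)" by simp
  then have "(\<integral>x. \<phi> x \<partial>lborel) * (\<integral>x. \<psi> x \<partial>lborel) \<le> exp (k * Phi k m F G)"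
    using F.Z_pos G.Z_pos by simp
  then show ?thesis
    unfolding F.mass_eq G.mass_eq using F.Z_pos G.Z_pos
    by (simp add: ennreal_mult[symmetric] ennreal_leI)
qed

section \<open>The standard Gaussian case\<close>

lemma std_gaussian_eq_gibbs: "std_gaussian = gibbs_measure (\<lambda>x. x\<^sup>2 / 2 + ln (sqrt (2 * pi)))"
proof -
  have "std_normal_density x = exp (- (x\<^sup>2 / 2 + ln (sqrt (2 * pi))))" for x :: real
  proof -
    have "exp (- (x\<^sup>2 / 2 + ln (sqrt (2 * pi)))) = exp (- x\<^sup>2 / 2) * exp (- ln (sqrt (2 * pi)))"
      unfolding exp_add[symmetric] by simp
    also have "exp (- ln (sqrt (2 * pi))) = 1 / sqrt (2 * pi)"
      unfolding exp_minus by (subst exp_ln) (auto simp: inverse_eq_divide)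
    finally show ?thesis unfolding std_normal_density_def by (simp only: mult.commute)
  qed
  then show ?thesis unfolding std_gaussian_def gibbs_measure_def by simp
qed

lemma deriv_gaussian_potential: "deriv (\<lambda>x::real. x\<^sup>2 / 2 + c) = (\<lambda>x. x)"
  by (rule ext, rule DERIV_imp_deriv) (auto intro!: derivative_eq_intros)

lemma smooth_gaussian_potential: "smooth (\<lambda>x. x\<^sup>2 / 2 + c)"
  unfolding smooth_def
proof (intro allI)
  fix n and x :: real
  have zero: "(deriv ^^ n) (\<lambda>x::real. 0) = (\<lambda>x. 0)" for n by (induction n) auto
  \<comment> \<open>The first derivative is the identity, the second is 1, and all later ones
    vanish.\<close>
  consider "n = 0" | "n = 1" | j where "n = Suc (Suc j)"
    by (metis One_nat_def not0_implies_Suc)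
  then show "(deriv ^^ n) (\<lambda>x. x\<^sup>2 / 2 + c) field_differentiable at x"
  proof cases
    case 1
    then show ?thesis by (auto simp: field_differentiable_def intro!: exI derivative_eq_intros)
  next
    case 2
    then show ?thesis by (simp add: deriv_gaussian_potential)
  next
    case (3 j)
    have "(deriv ^^ n) (\<lambda>x. x\<^sup>2 / 2 + c) = (deriv ^^ j) (\<lambda>x. 1)"
      unfolding 3 funpow_Suc_right comp_apply deriv_gaussian_potential by simp
    moreover have "(deriv ^^ j) (\<lambda>x::real. 1) field_differentiable at x"
    proof (cases j)
      case (Suc i)
      then show ?thesis unfolding Suc funpow_Suc_right comp_apply by (simp add: zero)
    qed simp
    ultimately show ?thesis by simp
  qed
qed

lemma prob_space_std_gaussian: "prob_space std_gaussian"
  unfolding std_gaussian_def by (rule prob_space_normal_density) simp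

lemma bar_std_gaussian: "bar std_gaussian = 0"
proof -
  have "bar std_gaussian = (\<integral>x. std_normal_density x *\<^sub>R x \<partial>lborel)"
    unfolding bar_def std_gaussian_def by (rule integral_density) auto
  then show ?thesis using integral_std_normal_moment_odd[of 0] by simp
qed

lemma gaussian_mass_bound_Phi:
  assumes "admissible 1 std_gaussian F" "admissible 1 std_gaussian G" "cost_dominated F G"
  shows "mass 1 std_gaussian F * mass 1 std_gaussian G \<le> ennreal (exp (Phi 1 std_gaussian F G))"
proof -
  have "kappa_convex 1 (\<lambda>x. x\<^sup>2 / 2 + ln (sqrt (2 * pi)))"
    unfolding kappa_convex_def deriv_gaussian_potential by simp
  from gibbs_mass_bound[OF _ smooth_gaussian_potential this std_gaussian_eq_gibbs prob_space_std_gaussian _ assms]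
  show ?thesis by simp
qed

lemma gaussian_mass_bound_bar:
  assumes F: "admissible 1 std_gaussian F" and G: "admissible 1 std_gaussian G" and FG: "cost_dominated F G"
  shows "mass 1 std_gaussian F * mass 1 std_gaussian G
    \<le> ennreal (exp (- (bar (tilt 1 std_gaussian F) * bar (tilt 1 std_gaussian G))))"
proof -
  define \<phi> where "\<phi> = (\<lambda>x. weight 1 F x * std_normal_density x)"
  define \<psi> where "\<psi> = (\<lambda>x. weight 1 G x * std_normal_density x)"
  define ZF where "ZF = (\<integral>x. \<phi> x \<partial>lborel)"
  define ZG where "ZG = (\<integral>x. \<psi> x \<partial>lborel)"
  interpret F: tilted_density 1 std_gaussian std_normal_density F \<phi> ZF
    by standard (use F cost_dominated_finite[OF FG] in \<open>auto simp: std_gaussian_def \<phi>_def ZF_def\<close>)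
  interpret G: tilted_density 1 std_gaussian std_normal_density G \<psi> ZG
    by standard (use G cost_dominated_finite[OF FG] in \<open>auto simp: std_gaussian_def \<psi>_def ZG_def\<close>)
  \<comment> \<open>The factor \<open>2 * pi\<close> compensates the normalising constants of two
    normal densities. It is carried by \<open>\<psi>\<close>, whose barycentre is invariant under
    scaling, and cancels against the Santalo constant.\<close>
  have le: "\<phi> x * (2 * pi * \<psi> y) \<le> exp (- (x * y))" for x y
  proof -
    have "\<phi> x * (2 * pi * \<psi> y) = (weight 1 F x * weight 1 G y) * (2 * pi * (std_normal_density x * std_normal_density y))"
      by (simp add: \<phi>_def \<psi>_def)
    also have "\<dots> \<le> exp (1 * ((x - y)\<^sup>2 / 2)) * (2 * pi * (std_normal_density x * std_normal_density y))"
      by (intro mult_right_mono weight_mult_le FG) auto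
    also have "2 * pi * (std_normal_density x * std_normal_density y) = exp (- x\<^sup>2 / 2) * exp (- y\<^sup>2 / 2)"
      by (simp add: std_normal_density_def)
    also have "exp (1 * ((x - y)\<^sup>2 / 2)) * (exp (- x\<^sup>2 / 2) * exp (- y\<^sup>2 / 2)) = exp (- (x * y))"
      by (simp add: mult_exp_exp power2_eq_square field_simps)
    finally show ?thesis .
  qed
  have "ZF * (2 * pi * ZG) \<le> 2 * pi * exp (- ((\<integral>x. x * \<phi> x \<partial>lborel) / ZF * ((\<integral>x. x * (2 * pi * \<psi> x) \<partial>lborel) / (2 * pi * ZG))))"
    using santalo_barycentres[of \<phi> "\<lambda>x. 2 * pi * \<psi> x"] F.phi_nonneg G.phi_nonneg F.integrable_phi
      F.integrable_ident_phi G.integrable_phi G.integrable_ident_phi le F.Z_pos G.Z_pos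
    by (simp add: ZF_def ZG_def mult.left_commute[of _ "2 * pi"])
  then have "ZF * ZG \<le> exp (- ((\<integral>x. x * \<phi> x \<partial>lborel) / ZF * ((\<integral>x. x * \<psi> x \<partial>lborel) / ZG)))"
    by (simp add: mult.left_commute[of _ "2 * pi"])
  then show ?thesis
    unfolding F.mass_eq G.mass_eq F.bar_eq G.bar_eq using F.Z_pos G.Z_pos
    by (simp add: ennreal_mult[symmetric] ennreal_leI)
qed

theorem theorem6p2:
  shows "(\<forall>(\<kappa>::real) (V::real \<Rightarrow> real) (m::real measure) (F::real \<Rightarrow> ereal) (G::real \<Rightarrow> ereal).
            0 < \<kappa> \<longrightarrow> smooth V \<longrightarrow> kappa_convex \<kappa> V \<longrightarrow>
            m = gibbs_measure V \<longrightarrow> prob_space m \<longrightarrow>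
            (\<forall>x. V 0 \<le> V x) \<longrightarrow>
            admissible \<kappa> m F \<longrightarrow> admissible \<kappa> m G \<longrightarrow>
            cost_dominated F G \<longrightarrow>
            (\<integral>\<^sup>+ x. ext_exp (ereal \<kappa> * F x) \<partial>m) * (\<integral>\<^sup>+ x. ext_exp (ereal \<kappa> * G x) \<partial>m)
              \<le> ennreal (exp (\<kappa> * Phi \<kappa> m F G)))
       \<and> (\<forall>(F::real \<Rightarrow> ereal) (G::real \<Rightarrow> ereal) (\<mu>F::real measure) (\<mu>G::real measure).
            admissible 1 std_gaussian F \<longrightarrow> admissible 1 std_gaussian G \<longrightarrow>
            \<mu>F = tilt 1 std_gaussian F \<longrightarrow> \<mu>G = tilt 1 std_gaussian G \<longrightarrow>
            Phi 1 std_gaussian F G =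
              - alpha std_gaussian \<mu>G * bar \<mu>F - alpha std_gaussian \<mu>F * bar \<mu>G
              + alpha std_gaussian \<mu>F * alpha std_gaussian \<mu>G
            \<and> (cost_dominated F G \<longrightarrow>
               (\<integral>\<^sup>+ x. ext_exp (F x) \<partial>std_gaussian) * (\<integral>\<^sup>+ x. ext_exp (G x) \<partial>std_gaussian)
                 \<le> ennreal (exp (min (Phi 1 std_gaussian F G) (- (bar \<mu>F * bar \<mu>G))))))"
proof (intro conjI allI impI)
  fix \<kappa> :: real and V :: "real \<Rightarrow> real" and m and F G :: "real \<Rightarrow> ereal"
  assume "0 < \<kappa>" "smooth V" "kappa_convex \<kappa> V" "m = gibbs_measure V" "prob_space m"
    "\<forall>x. V 0 \<le> V x" "admissible \<kappa> m F" "admissible \<kappa> m G" "cost_dominated F G"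
  then show "(\<integral>\<^sup>+ x. ext_exp (ereal \<kappa> * F x) \<partial>m) * (\<integral>\<^sup>+ x. ext_exp (ereal \<kappa> * G x) \<partial>m)
      \<le> ennreal (exp (\<kappa> * Phi \<kappa> m F G))"
    using gibbs_mass_bound[of \<kappa> V m F G] unfolding mass_def by blast
next
  fix F G :: "real \<Rightarrow> ereal" and \<mu>F \<mu>G
  assume F: "admissible 1 std_gaussian F" and G: "admissible 1 std_gaussian G"
    and \<mu>: "\<mu>F = tilt 1 std_gaussian F" "\<mu>G = tilt 1 std_gaussian G"
  show "Phi 1 std_gaussian F G =
              - alpha std_gaussian \<mu>G * bar \<mu>F - alpha std_gaussian \<mu>F * bar \<mu>G
              + alpha std_gaussian \<mu>F * alpha std_gaussian \<mu>G"
    \<comment> \<open>The Gaussian has barycentre 0, so the last summand of \<open>Phi\<close>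
      vanishes.\<close>
    by (simp add: Phi_def \<mu> bar_std_gaussian Let_def)
  assume "cost_dominated F G"
  note bounds = gaussian_mass_bound_Phi[OF F G this] gaussian_mass_bound_bar[OF F G this]
  have one: "ereal 1 * u = u" for u :: ereal by (simp flip: one_ereal_def)
  show "(\<integral>\<^sup>+ x. ext_exp (F x) \<partial>std_gaussian) * (\<integral>\<^sup>+ x. ext_exp (G x) \<partial>std_gaussian)
                 \<le> ennreal (exp (min (Phi 1 std_gaussian F G) (- (bar \<mu>F * bar \<mu>G))))"
    using bounds unfolding mass_def one \<mu> by (simp add: min_def)
qed

end
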